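(* Let $n,k$ be positive integers with $k\le n$. (a) If $n\le2$, then $\mathfrak r_{\triangle_{n,k}}$ is $p$-positive. (b) If $n\ge3$ is odd, then $\mathfrak r_{\triangle_{n,k}}$ is $p$-positive if and only if $k\in\{1,3,n-2,n\}$. (c) If $n\ge4$ is even, then $\mathfrak r_{\triangle_{n,k}}$ is $p$-positive if and only if $k\in\{1,3,n/2,n/2+1,n-2,n\}$.
   Context: Boxes $(r,c)$ are indexed by row $r$ (top to bottom) and column $c$. A connected ribbon of composition $\alpha=(\alpha_1,\dots,\alpha_\ell)$ has $\alpha_r$ consecutive boxes in row $r$, with the leftmost box of row $r$ directly above the rightmost box of row $r+1$. For a ribbon $D$, $\mathfrak r_D=\sum_T x^{c(T)}$ over fillings $T$ of $D$ with letters of $\{1'<1<2'<2<\cdots\}$ having rows and columns weakly increasing, at most one unmarked $k$ per column and at most one marked $k'$ per row; $c(T)_i$ counts entries $i$ or $i'$. $\triangle_{n,k}$ ($1\le k\le n$) is the ribbon of composition $(1^{k-1},n-k+1)$. A symmetric function is $p$-positive if all its coefficients in the power sum basis $\{p_\lambda\}$ are nonnegative. *)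

theory Defs
  imports Complex_Main
begin

text \<open>Boxes are pairs (row, column), 0-indexed. A composition is a list of positive
  naturals; row r (0-indexed) of the ribbon has alpha!r boxes. The last row starts
  in column 0, and the leftmost box of row r lies directly above the rightmost box
  of row r+1, so the leftmost column of row r is the sum of (alpha!j - 1) for j > r.\<close>

definition ribbon_left :: "nat list \<Rightarrow> nat \<Rightarrow> nat" where
  "ribbon_left alpha r = (\<Sum>j\<in>{r<..<length alpha}. alpha ! j - 1)"

definition ribbon :: "nat list \<Rightarrow> (nat \<times> nat) set" where
  "ribbon alpha = {(r, c). r < length alpha \<and> ribbon_left alpha r \<le> c
                      \<and> c < ribbon_left alpha r + alpha ! r}"

definition triangle :: "nat \<Rightarrow> nat \<Rightarrow> (nat \<times> nat) set" where
  "triangle n k = ribbon (replicate (k - 1) 1 @ [n - k + 1])"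

text \<open>Letters 1' < 1 < 2' < 2 < ... are encoded as naturals 0 < 1 < 2 < 3 < ...:
  the code m stands for the letter with value (m div 2) + 1, marked iff m is even.
  Variables x_1, x_2, ... are indexed 0, 1, ...; the letter with code m contributes
  to variable m div 2.\<close>

definition valid_filling :: "(nat \<times> nat) set \<Rightarrow> (nat \<times> nat \<Rightarrow> nat) \<Rightarrow> bool" where
  "valid_filling D T \<longleftrightarrow>
     (\<forall>r c c'. (r, c) \<in> D \<longrightarrow> (r, c') \<in> D \<longrightarrow> c < c' \<longrightarrow> T (r, c) \<le> T (r, c')) \<and>
     (\<forall>r r' c. (r, c) \<in> D \<longrightarrow> (r', c) \<in> D \<longrightarrow> r < r' \<longrightarrow> T (r, c) \<le> T (r', c)) \<and>
     (\<forall>r r' c. (r, c) \<in> D \<longrightarrow> (r', c) \<in> D \<longrightarrow> r \<noteq> r' \<longrightarrow> odd (T (r, c))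
          \<longrightarrow> T (r, c) \<noteq> T (r', c)) \<and>
     (\<forall>r c c'. (r, c) \<in> D \<longrightarrow> (r, c') \<in> D \<longrightarrow> c \<noteq> c' \<longrightarrow> even (T (r, c))
          \<longrightarrow> T (r, c) \<noteq> T (r, c'))"

definition content :: "(nat \<times> nat) set \<Rightarrow> (nat \<times> nat \<Rightarrow> nat) \<Rightarrow> nat \<Rightarrow> nat" where
  "content D T i = card {b \<in> D. T b div 2 = i}"

text \<open>Coefficient of the monomial x^a in r_D (fillings are taken extensional: 0 off D).\<close>
definition rcoef :: "(nat \<times> nat) set \<Rightarrow> (nat \<Rightarrow> nat) \<Rightarrow> nat" where
  "rcoef D a = card {T. (\<forall>b. b \<notin> D \<longrightarrow> T b = 0) \<and> valid_filling D T \<and> content D T = a}"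

definition is_partition :: "nat list \<Rightarrow> bool" where
  "is_partition mu \<longleftrightarrow> sorted (rev mu) \<and> 0 \<notin> set mu"

text \<open>Coefficient of x^a in p_mu = prod_i (sum_j x_j^(mu_i)): number of ways to assign
  a variable to each part of mu such that the exponents add up to a.\<close>
definition pcoef :: "nat list \<Rightarrow> (nat \<Rightarrow> nat) \<Rightarrow> nat" where
  "pcoef mu a = card {vs :: nat list. length vs = length mu \<and>
      (\<forall>j. (\<Sum>i<length mu. if vs ! i = j then mu ! i else 0) = a j)}"

text \<open>A formal power series (given by its coefficient function on exponent vectors)
  is p-positive if it is a nonnegative (finite) linear combination of power sums.\<close>
definition p_positive :: "((nat \<Rightarrow> nat) \<Rightarrow> real) \<Rightarrow> bool" where
  "p_positive F \<longleftrightarrow> (\<exists>C c. finite C \<and> (\<forall>mu\<in>C. is_partition mu \<and> c mu \<ge> (0::real)) \<and>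
      (\<forall>a. F a = (\<Sum>mu\<in>C. c mu * real (pcoef mu a))))"

definition rfun :: "(nat \<times> nat) set \<Rightarrow> (nat \<Rightarrow> nat) \<Rightarrow> real" where
  "rfun D a = real (rcoef D a)"

end

theory Submission
  imports "HOL-Computational_Algebra.Formal_Power_Series" "HOL-Library.Multiset" Defs
begin

text \<open>Write $T_{n,k}$ for the series of the hook and $q_j$ for that of a row (or column) of $j$ boxes.
  Joining a row of $n-k$ boxes and a column of $k$ boxes in the two possible ways gives
  $T_{n,k} + T_{n,k+1} = q_k q_{n-k}$. As $\sum_j q_j t^j = \exp(2 \sum_{m\ odd} p_m t^m / m)$, the
  coefficient of $p_\mu$ in $T_{n,k}$ is $2^{\ell(\mu)} / z_\mu$ times the coefficient of $u^{k-1}$ in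
  $A_\mu(u) = \prod_i (1 + u^{\mu_i}) / (1 + u)$ for $\mu$ with odd parts only, and $0$ otherwise.
  The polynomial $A_\mu$ is palindromic of degree $n - 1$. Its coefficient at $u^2$ is
  $(c-1)(c-2)/2$ with $c$ the number of parts $1$, and for even $n$ its middle coefficients are half
  the number of sets of parts with sum $n/2$. In all other cases one of the partitions $(n)$,
  $(k-2,3,n-k-1)$, $(k+1,n-k-1)$, $(k-2,3,3,n-k-4)$ yields a negative coefficient, possibly
  after replacing $k$ by $n+1-k$.

  Identities of symmetric functions are checked by evaluation at real $x_0, \dots, x_{N-1}$ for
  all $N$.\<close>

unbundle fps_syntax

section \<open>Weakly increasing words and Schur q-functions\<close>

text \<open>Two points shape the proof. First, \<open>p_positive\<close> admits any finite
  combination of power sums and tests it at every exponent vector, so a negative coefficient in one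
  expansion refutes nothing until the power sums are known to be independent; evaluation at real
  points has to be turned back into equality of coefficients. The exponential is never formed: its
  logarithmic derivative gives a recursion for the q_j, and the weights 2^l/z_mu satisfy a matching
  one when a part of mu is removed. Second, the witnesses come from 1/(1 + u), whose coefficients
  are (-1)^j. At u^(k-1) a choice of r parts with sum at most k - 1 contributes (-1)^(k-1+r), as all
  parts are odd, and larger sums are invisible. For even k it is enough that every part exceeds k -
  1. For odd k the empty choice gives +1, so there must be small parts but few pairs of them: k - 2
  and 3 both count, while their sum k + 1 does not. A part 1 would cancel 1 + u and leave only
  nonnegative coefficients, so all parts are at least 3; their number has the parity of n, whence
  the second 3 for even n.\<close>

definition step :: "(nat \<Rightarrow> bool) \<Rightarrow> nat \<Rightarrow> nat \<Rightarrow> bool" where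
  "step P x y \<longleftrightarrow> x < y \<or> x = y \<and> P x"

abbreviation weight :: "(nat \<Rightarrow> real) \<Rightarrow> nat list \<Rightarrow> real" where
  "weight x w \<equiv> (\<Prod>m\<leftarrow>w. x (m div 2))"

definition chain_words :: "(nat \<Rightarrow> bool) \<Rightarrow> nat \<Rightarrow> nat \<Rightarrow> nat list set" where
  "chain_words P M n = {w. length w = n \<and> set w \<subseteq> {..<M} \<and> sorted_wrt (step P) w}"

definition chain_series :: "(nat \<Rightarrow> bool) \<Rightarrow> (nat \<Rightarrow> real) \<Rightarrow> nat \<Rightarrow> real fps" where
  "chain_series P x M = Abs_fps (\<lambda>n. \<Sum>w\<in>chain_words P M n. weight x w)"

lemma finite_chain_words [simp]: "finite (chain_words P M n)"
  by (rule finite_subset[OF _ finite_lists_length_eq[of "{..<M}" n]]) (auto simp: chain_words_def)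

lemma chain_words_0 [simp]: "chain_words P M 0 = {[]}"
  by (auto simp: chain_words_def)

text \<open>A word either avoids the top letter \<open>M\<close> or ends in it; once that final
  \<open>M\<close> is deleted, another \<open>M\<close> can remain only if
  \<open>P M\<close>.\<close>

lemma chain_words_Suc:
  "chain_words P (Suc M) (Suc n) =
     chain_words P M (Suc n) \<union> (\<lambda>u. u @ [M]) ` chain_words P (if P M then Suc M else M) n" (is "?L = ?R")
proof (intro equalityI subsetI)
  fix w assume w: "w \<in> ?L"
  then have "w \<noteq> []" by (auto simp: chain_words_def)
  then obtain u m where wu: "w = u @ [m]" by (metis rev_exhaust)
  have u: "length u = n" "set u \<subseteq> {..<Suc M}" "m \<le> M" "sorted_wrt (step P) u"
    and s: "\<And>y. y \<in> set u \<Longrightarrow> step P y m"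
    using w by (auto simp: chain_words_def wu sorted_wrt_append)
  show "w \<in> ?R"
  proof (cases "m = M")
    case True
    have "y < M" if "\<not> P M" "y \<in> set u" for y
      using s[OF that(2)] that(1) True by (auto simp: step_def)
    then have "u \<in> chain_words P (if P M then Suc M else M) n"
      using u by (auto simp: chain_words_def)
    then show ?thesis using wu True by blast
  next
    case False
    have "y < M" if "y \<in> set u" for y
      using s[OF that] False u(3) by (auto simp: step_def)
    then have "w \<in> chain_words P M (Suc n)"
      using w u(3) False by (auto simp: chain_words_def wu)
    then show ?thesis by blast
  qed
next
  fix w assume "w \<in> ?R"
  then show "w \<in> ?L"
    by (auto simp: chain_words_def sorted_wrt_append step_def less_Suc_eq subset_iff
        split: if_splits)
qed

lemma chain_series_nth_Suc:
  "chain_series P x (Suc M) $ Suc n = chain_series P x M $ Suc n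
     + x (M div 2) * chain_series P x (if P M then Suc M else M) $ n"
proof -
  let ?B = "chain_words P (if P M then Suc M else M) n"
  have inj: "inj_on (\<lambda>u. u @ [M]) ?B" by (auto simp: inj_on_def)
  have disj: "chain_words P M (Suc n) \<inter> (\<lambda>u. u @ [M]) ` ?B = {}"
    by (auto simp: chain_words_def)
  have "chain_series P x (Suc M) $ Suc n =
      (\<Sum>w\<in>chain_words P M (Suc n) \<union> (\<lambda>u. u @ [M]) ` ?B. weight x w)"
    by (simp add: chain_series_def chain_words_Suc)
  also have "\<dots> = (\<Sum>w\<in>chain_words P M (Suc n). weight x w) + (\<Sum>w\<in>?B. weight x (w @ [M]))"
    by (subst sum.union_disjoint) (use disj in \<open>auto simp: sum.reindex[OF inj]\<close>)
  also have "(\<Sum>w\<in>?B. weight x (w @ [M])) = x (M div 2) * (\<Sum>w\<in>?B. weight x w)"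
    by (simp add: sum_distrib_left mult.commute)
  finally show ?thesis by (simp add: chain_series_def)
qed

lemma chain_series_nth_0 [simp]: "chain_series P x M $ 0 = 1"
  by (simp add: chain_series_def)

lemma chain_series_0 [simp]: "chain_series P x 0 = 1"
proof (rule fps_ext)
  fix n show "chain_series P x 0 $ n = 1 $ n"
    by (cases n) (auto simp: chain_series_def chain_words_def[of _ _ "Suc _"])
qed

text \<open>For a repeatable letter the recursion refers back to the same series, so the letter
  contributes the geometric factor 1/(1 - x t), stated here without division.\<close>

lemma chain_series_Suc_repeat:
  assumes "P M"
  shows "(1 - fps_const (x (M div 2)) * fps_X) * chain_series P x (Suc M) = chain_series P x M"
proof (rule fps_ext)
  fix n
  show "((1 - fps_const (x (M div 2)) * fps_X) * chain_series P x (Suc M)) $ n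
      = chain_series P x M $ n"
    using assms chain_series_nth_Suc[of P x M]
    by (cases n) (auto simp: algebra_simps mult.assoc)
qed

lemma chain_series_Suc_strict:
  assumes "\<not> P M"
  shows "chain_series P x (Suc M) = (1 + fps_const (x (M div 2)) * fps_X) * chain_series P x M"
proof (rule fps_ext)
  fix n
  show "chain_series P x (Suc M) $ n
      = ((1 + fps_const (x (M div 2)) * fps_X) * chain_series P x M) $ n"
    using assms chain_series_nth_Suc[of P x M]
    by (cases n) (auto simp: algebra_simps mult.assoc)
qed

text \<open>The generating function of Schur's q-functions: one repeatable and one non-repeatable
  letter for each variable.\<close>

definition schur_q :: "(nat \<Rightarrow> real) \<Rightarrow> nat \<Rightarrow> real fps" where
  "schur_q x N = (\<Prod>i<N. (1 + fps_const (x i) * fps_X) * inverse (1 - fps_const (x i) * fps_X))"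

lemma inverse_one_minus_X:
  fixes c :: real
  shows "(1 - fps_const c * fps_X) * inverse (1 - fps_const c * fps_X) = 1"
  by (rule inverse_mult_eq_1') simp

text \<open>The two letters of one value contribute 1 + x_i t and 1/(1 - x_i t), and these factors
  commute. Hence rows (\<open>b\<close> false) and columns (\<open>b\<close> true) have the same
  series.\<close>

lemma chain_series_eq_schur_q:
  assumes P: "\<And>i. P (2 * i) \<longleftrightarrow> b" "\<And>i. P (Suc (2 * i)) \<longleftrightarrow> \<not> b"
  shows "chain_series P x (2 * N) = schur_q x N"
proof (induction N)
  case 0
  show ?case by (simp add: schur_q_def)
next
  case (Suc N)
  let ?m = "1 - fps_const (x N) * fps_X" and ?p = "1 + fps_const (x N) * fps_X"
  have "?m * chain_series P x (Suc (Suc (2 * N))) = ?p * chain_series P x (2 * N)"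
  proof (cases b)
    case True
    have "chain_series P x (Suc (Suc (2 * N))) = ?p * chain_series P x (Suc (2 * N))"
      using chain_series_Suc_strict[of P "Suc (2 * N)" x] P True by simp
    moreover have "?m * chain_series P x (Suc (2 * N)) = chain_series P x (2 * N)"
      using chain_series_Suc_repeat[of P "2 * N" x] P True by simp
    ultimately show ?thesis by (metis mult.left_commute)
  next
    case False
    have "?m * chain_series P x (Suc (Suc (2 * N))) = chain_series P x (Suc (2 * N))"
      using chain_series_Suc_repeat[of P "Suc (2 * N)" x] P False by simp
    moreover have "chain_series P x (Suc (2 * N)) = ?p * chain_series P x (2 * N)"
      using chain_series_Suc_strict[of P "2 * N" x] P False by simp
    ultimately show ?thesis by simp
  qed
  then have "(inverse ?m * ?m) * chain_series P x (Suc (Suc (2 * N)))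
      = inverse ?m * ?p * chain_series P x (2 * N)"
    by (simp only: mult.assoc)
  moreover have "inverse ?m * ?m = 1"
    using inverse_one_minus_X by (simp add: mult.commute)
  ultimately have "chain_series P x (Suc (Suc (2 * N))) = inverse ?m * ?p * chain_series P x (2 * N)"
    by simp
  then have "chain_series P x (2 * Suc N) = inverse ?m * ?p * schur_q x N"
    by (simp add: Suc)
  then show ?case
    by (simp only: schur_q_def prod.lessThan_Suc mult_ac)
qed

section \<open>Logarithmic derivative and odd power sums\<close>

definition power_sum :: "(nat \<Rightarrow> real) \<Rightarrow> nat \<Rightarrow> nat \<Rightarrow> real" where
  "power_sum x N m = (\<Sum>i<N. x i ^ m)"

text \<open>The logarithmic derivative of (1 + ct)/(1 - ct) is 2c/(1 - c^2 t^2); times t it contains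
  only odd powers. This is where the even power sums disappear.\<close>

lemma schur_q_factor_deriv:
  fixes c :: real
  defines "f \<equiv> (1 + fps_const c * fps_X) * inverse (1 - fps_const c * fps_X)"
  shows "fps_X * fps_deriv f = 2 * Abs_fps (\<lambda>m. if odd m then c ^ m else 0) * f"
proof -
  let ?x = "fps_const c * fps_X :: real fps" and ?l = "Abs_fps (\<lambda>m. if odd m then c ^ m else 0)"
  have f: "(1 - ?x) * f = 1 + ?x"
    using inverse_one_minus_X[of c] by (simp add: f_def mult.left_commute)
  have df: "(1 - ?x) * fps_deriv f = fps_const c + fps_const c * f"
  proof -
    have "fps_deriv ((1 - ?x) * f) = fps_const c" by (simp add: f)
    then show ?thesis by (simp add: algebra_simps)
  qed
  \<comment> \<open>\<open>?l\<close> is the expansion of ct/(1 - c^2 t^2). The denominator is kept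
    on the left throughout and cancelled at the end.\<close>
  have l: "(1 - ?x * ?x) * ?l = ?x"
  proof (rule fps_ext)
    fix n
    have e: "(1 - ?x * ?x) * ?l = ?l - fps_const (c\<^sup>2) * (fps_X ^ 2 * ?l)"
      by (simp add: algebra_simps power2_eq_square flip: fps_const_mult)
    have e2: "(fps_X ^ 2 * ?l) $ n = (if n < 2 then 0 else ?l $ (n - 2))"
      by (rule fps_X_power_mult_nth)
    show "((1 - ?x * ?x) * ?l) $ n = ?x $ n"
    proof (cases "n < 2")
      case True
      then show ?thesis unfolding e fps_sub_nth fps_mult_left_const_nth e2 by (auto simp: less_2_cases_iff)
    next
      case False
      then obtain k where "n = k + 2" by (metis add.commute le_Suc_ex not_less)
      then show ?thesis unfolding e fps_sub_nth fps_mult_left_const_nth e2 by (simp add: power2_eq_square)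
    qed
  qed
  have "(1 - ?x * ?x) * (fps_X * fps_deriv f) = fps_X * (1 + ?x) * ((1 - ?x) * fps_deriv f)"
    by (simp add: algebra_simps)
  also have "\<dots> = ?x * (1 + ?x) + ?x * (1 + ?x) * f"
    by (simp only: df) (simp add: algebra_simps)
  also have "\<dots> = ?x * ((1 - ?x) * f) + ?x * (1 + ?x) * f"
    by (simp only: f)
  also have "\<dots> = 2 * ?x * f"
    by (simp add: algebra_simps)
  also have "\<dots> = (1 - ?x * ?x) * (2 * ?l * f)"
    by (subst l[symmetric]) (simp add: mult_ac)
  finally have eq: "(1 - ?x * ?x) * (fps_X * fps_deriv f) = (1 - ?x * ?x) * (2 * ?l * f)" .
  have "(1 - ?x * ?x) $ 0 \<noteq> 0" by simp
  then have "1 - ?x * ?x \<noteq> 0" by (metis fps_zero_nth)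
  then show ?thesis using eq by (rule mult_left_cancel[THEN iffD1])
qed

lemma schur_q_deriv:
  "fps_X * fps_deriv (schur_q x N)
     = 2 * Abs_fps (\<lambda>m. if odd m then power_sum x N m else 0) * schur_q x N"
proof (induction N)
  case 0
  have "Abs_fps (\<lambda>m. if odd m then power_sum x 0 m else 0) = 0"
    by (rule fps_ext) (simp add: power_sum_def)
  then show ?case by (simp add: schur_q_def)
next
  case (Suc N)
  let ?f = "(1 + fps_const (x N) * fps_X) * inverse (1 - fps_const (x N) * fps_X)"
  let ?l = "Abs_fps (\<lambda>m. if odd m then x N ^ m else 0)"
  let ?L = "\<lambda>N. Abs_fps (\<lambda>m. if odd m then power_sum x N m else 0)"
  have L: "?L (Suc N) = ?L N + ?l"
    by (rule fps_ext) (simp add: power_sum_def)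
  have Q: "schur_q x (Suc N) = schur_q x N * ?f"
    by (simp add: schur_q_def)
  have "fps_X * fps_deriv (schur_q x (Suc N))
      = (fps_X * fps_deriv (schur_q x N)) * ?f + schur_q x N * (fps_X * fps_deriv ?f)"
    unfolding Q fps_deriv_mult by (simp only: algebra_simps)
  also have "\<dots> = 2 * (?L N + ?l) * (schur_q x N * ?f)"
    unfolding Suc schur_q_factor_deriv by (simp only: algebra_simps)
  finally show ?case unfolding L Q .
qed

text \<open>The coefficient of t^j in \<open>schur_q_deriv\<close>. Together with q_0 = 1 it
  determines every q_j from odd power sums and so stands in for the exponential formula.\<close>

lemma schur_q_newton:
  "real j * schur_q x N $ j
     = (\<Sum>m | odd m \<and> m \<le> j. 2 * power_sum x N m * schur_q x N $ (j - m))"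
proof -
  let ?L = "Abs_fps (\<lambda>m. if odd m then power_sum x N m else 0)"
  have "real j * schur_q x N $ j = (fps_X * fps_deriv (schur_q x N)) $ j"
    by (cases j) auto
  also have "\<dots> = (fps_const 2 * (?L * schur_q x N)) $ j"
    unfolding schur_q_deriv by (simp add: numeral_fps_const mult.assoc)
  also have "\<dots> = 2 * (?L * schur_q x N) $ j"
    by (rule fps_mult_left_const_nth)
  also have "\<dots> = (\<Sum>m=0..j. if odd m then 2 * power_sum x N m * schur_q x N $ (j - m) else 0)"
    unfolding fps_mult_nth sum_distrib_left
    by (rule sum.cong[OF refl]) simp
  also have "\<dots> = (\<Sum>m | odd m \<and> m \<le> j. 2 * power_sum x N m * schur_q x N $ (j - m))"
  proof (rule sum.mono_neutral_cong_right)
    show "finite {0..j}" by simp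
    show "{m. odd m \<and> m \<le> j} \<subseteq> {0..j}" by auto
  qed auto
  finally show ?thesis .
qed

section \<open>Fillings of the hook as words\<close>

text \<open>Odd codes are the unmarked letters, which may repeat in a row; even codes are the marked
  ones, which may repeat in a column. Columns are read upwards, hence the swapped arguments of
  \<open>column_step\<close>.\<close>

abbreviation row_step :: "nat \<Rightarrow> nat \<Rightarrow> bool" where
  "row_step \<equiv> step odd"

abbreviation column_step :: "nat \<Rightarrow> nat \<Rightarrow> bool" where
  "column_step x y \<equiv> step even y x"

text \<open>This dichotomy drives the recursion for hooks: a letter can be followed by another
  either to the right or upwards, and never in both ways.\<close>

lemma column_step_iff: "column_step x y \<longleftrightarrow> \<not> row_step x y"
  by (auto simp: step_def)

lemma step_trans: "step P x y \<Longrightarrow> step P y z \<Longrightarrow> step P x z"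
  by (auto simp: step_def)

text \<open>The two slices overlap: position n - k is the corner box, which belongs to the row and
  to the column.\<close>

definition hook_words :: "nat \<Rightarrow> nat \<Rightarrow> nat list set" where
  "hook_words n k = {w. length w = n \<and> sorted_wrt row_step (take (Suc (n - k)) w)
                        \<and> sorted_wrt column_step (drop (n - k) w)}"

definition hook_sum :: "(nat \<Rightarrow> real) \<Rightarrow> nat \<Rightarrow> nat \<Rightarrow> nat \<Rightarrow> real" where
  "hook_sum x N n k = (\<Sum>w | w \<in> hook_words n k \<and> set w \<subseteq> {..<2 * N}. weight x w)"

lemma chain_words_column:
  "{w. length w = n \<and> set w \<subseteq> {..<M} \<and> sorted_wrt column_step w} = rev ` chain_words even M n"
proof (intro equalityI subsetI)
  fix w assume "w \<in> {w. length w = n \<and> set w \<subseteq> {..<M} \<and> sorted_wrt column_step w}"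
  then have "rev w \<in> chain_words even M n"
    by (simp add: chain_words_def sorted_wrt_rev)
  then show "w \<in> rev ` chain_words even M n" by force
qed (auto simp: chain_words_def sorted_wrt_rev)

lemma weight_rev [simp]: "weight x (rev w) = weight x w"
  by (induction w) (auto simp: mult_ac)

lemma sum_column_words:
  "(\<Sum>w | length w = n \<and> set w \<subseteq> {..<2 * N} \<and> sorted_wrt column_step w. weight x w)
     = schur_q x N $ n"
proof -
  have "inj_on rev (chain_words even (2 * N) n)" by (simp add: inj_on_def)
  then show ?thesis
    unfolding chain_words_column
    using chain_series_eq_schur_q[of even True x N]
    by (simp add: sum.reindex chain_series_def fps_eq_iff)
qed

lemma sum_row_words:
  "(\<Sum>w | length w = n \<and> set w \<subseteq> {..<2 * N} \<and> sorted_wrt row_step w. weight x w)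
     = schur_q x N $ n"
  using chain_series_eq_schur_q[of odd False x N]
  by (simp add: chain_series_def fps_eq_iff chain_words_def)

lemma hook_sum_first:
  assumes "1 \<le> n" shows "hook_sum x N n 1 = schur_q x N $ n"
proof -
  have "sorted_wrt column_step (drop (n - 1) w)" if "length w = n" for w
    using that assms by (cases "drop (n - 1) w") (auto dest: arg_cong[of _ _ length])
  then have "{w. w \<in> hook_words n 1 \<and> set w \<subseteq> {..<2 * N}}
      = {w. length w = n \<and> set w \<subseteq> {..<2 * N} \<and> sorted_wrt row_step w}"
    using assms by (auto simp: hook_words_def)
  then show ?thesis unfolding hook_sum_def using sum_row_words by simp
qed

lemma hook_sum_last:
  assumes "1 \<le> n" shows "hook_sum x N n n = schur_q x N $ n"
proof -
  have "sorted_wrt row_step (take (Suc 0) w)" for w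
    by (cases w) auto
  then have "{w. w \<in> hook_words n n \<and> set w \<subseteq> {..<2 * N}}
      = {w. length w = n \<and> set w \<subseteq> {..<2 * N} \<and> sorted_wrt column_step w}"
    by (auto simp: hook_words_def)
  then show ?thesis unfolding hook_sum_def using sum_column_words by simp
qed

text \<open>The right-hand set leaves open how positions n - k - 1 and n - k compare. A row step
  there makes n - k the corner, a column step makes n - k - 1 the corner, and
  \<open>column_step_iff\<close> says that exactly one occurs.\<close>

lemma hook_words_split:
  assumes "1 \<le> k" "k < n"
  shows "hook_words n k \<union> hook_words n (Suc k) =
      {w. length w = n \<and> sorted_wrt row_step (take (n - k) w)
                       \<and> sorted_wrt column_step (drop (n - k) w)}" (is "?H \<union> ?H' = ?J")
    and "hook_words n k \<inter> hook_words n (Suc k) = {}"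
proof -
  have shape: "\<exists>u b c v. w = u @ b # c # v \<and> length u = n - Suc k" if "length w = n" for w :: "nat list"
  proof -
    have "length (drop (n - Suc k) w) = Suc k" using that assms by simp
    then obtain b c v where "drop (n - Suc k) w = b # c # v"
      using assms(1) by (metis Suc_le_length_iff le_refl Suc_le_mono One_nat_def)
    then show ?thesis
      using that by (metis append_take_drop_id length_take min.absorb2 diff_le_self)
  qed
  have iff: "(w \<in> ?H \<longleftrightarrow> w \<in> ?J \<and> row_step b c) \<and> (w \<in> ?H' \<longleftrightarrow> w \<in> ?J \<and> column_step b c)"
    if w: "w = u @ b # c # v" "length u = n - Suc k" "length w = n" for w u b c v
  proof -
    have nk: "n - k = Suc (length u)" using w assms by simp
    \<comment> \<open>\<open>sorted_wrt\<close> compares all pairs, so the single comparison of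
      \<open>b\<close> with \<open>c\<close> has to be carried to the rest of the row or column by
      transitivity.\<close>
    have tr: "row_step y c" if "row_step y b" "row_step b c" for y
      using that step_trans by blast
    have tc: "column_step b y" if "column_step c y" "column_step b c" for y
      using that step_trans by blast
    show ?thesis
      using w(3) unfolding w(1)
      by (auto simp: hook_words_def nk w(2)[symmetric] sorted_wrt_append intro: tr tc)
  qed
  have "(w \<in> ?H \<or> w \<in> ?H' \<longleftrightarrow> w \<in> ?J) \<and> \<not> (w \<in> ?H \<and> w \<in> ?H')" for w
  proof (cases "length w = n")
    case True
    then obtain u b c v where "w = u @ b # c # v" "length u = n - Suc k"
      using shape by blast
    from iff[OF this True] show ?thesis
      using column_step_iff[of c b] by argo
  next
    case False
    then show ?thesis by (simp add: hook_words_def)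
  qed
  then show "?H \<union> ?H' = ?J" "?H \<inter> ?H' = {}" by blast+
qed

lemma finite_words: "finite {w. w \<in> hook_words n k \<and> set w \<subseteq> {..<2 * N}}"
  by (rule finite_subset[OF _ finite_lists_length_eq[of "{..<2 * N}" n]])
    (auto simp: hook_words_def)

lemma hook_sum_add:
  assumes "1 \<le> k" "k < n"
  shows "hook_sum x N n k + hook_sum x N n (Suc k) = schur_q x N $ k * schur_q x N $ (n - k)"
proof -
  let ?R = "{w. length w = n - k \<and> set w \<subseteq> {..<2 * N} \<and> sorted_wrt row_step w}"
  let ?C = "{w. length w = k \<and> set w \<subseteq> {..<2 * N} \<and> sorted_wrt column_step w}"
  let ?J = "{w. length w = n \<and> sorted_wrt row_step (take (n - k) w)
                       \<and> sorted_wrt column_step (drop (n - k) w)}"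
  have "hook_sum x N n k + hook_sum x N n (Suc k)
      = (\<Sum>w\<in>{w. w \<in> hook_words n k \<and> set w \<subseteq> {..<2 * N}} \<union>
              {w. w \<in> hook_words n (Suc k) \<and> set w \<subseteq> {..<2 * N}}. weight x w)"
    unfolding hook_sum_def
    by (rule sum.union_disjoint[symmetric])
      (use hook_words_split(2)[OF assms] finite_words in auto)
  also have "{w. w \<in> hook_words n k \<and> set w \<subseteq> {..<2 * N}} \<union>
              {w. w \<in> hook_words n (Suc k) \<and> set w \<subseteq> {..<2 * N}}
      = {w. w \<in> ?J \<and> set w \<subseteq> {..<2 * N}}"
    using hook_words_split(1)[OF assms] by blast
  also have "(\<Sum>w\<in>\<dots>. weight x w) = (\<Sum>(u, v)\<in>?R \<times> ?C. weight x u * weight x v)"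
  proof (rule sum.reindex_bij_witness[of _ "\<lambda>(u, v). u @ v" "\<lambda>w. (take (n - k) w, drop (n - k) w)"])
    fix w assume w: "w \<in> {w. w \<in> ?J \<and> set w \<subseteq> {..<2 * N}}"
    then show "(take (n - k) w, drop (n - k) w) \<in> ?R \<times> ?C"
      using assms by (auto dest: in_set_takeD in_set_dropD)
    have "weight x w = weight x (take (n - k) w @ drop (n - k) w)" by simp
    then show "(case (take (n - k) w, drop (n - k) w) of (u, v) \<Rightarrow> weight x u * weight x v) = weight x w"
      by (simp only: map_append prod_list.append prod.case)
  qed (use assms in auto)
  also have "\<dots> = (\<Sum>u\<in>?R. weight x u) * (\<Sum>v\<in>?C. weight x v)"
    by (simp add: sum_product sum.cartesian_product)
  finally show ?thesis unfolding sum_row_words sum_column_words by (simp add: mult.commute)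
qed

text \<open>The hook with index k sits at u^(k-1), so multiplication by 1 + u adds neighbouring
  hooks. At u^0 and u^n only one hook is left, which matches q_0 q_n = q_n q_0 because q_0 =
  1.\<close>

lemma hook_series:
  assumes "1 \<le> n"
  shows "(1 + fps_X) * Abs_fps (\<lambda>k. if k < n then hook_sum x N n (Suc k) else 0)
    = Abs_fps (\<lambda>j. if j \<le> n then schur_q x N $ j * schur_q x N $ (n - j) else 0)"
proof (rule fps_ext)
  have q0: "schur_q x N $ 0 = 1"
    using chain_series_eq_schur_q[of odd False x N] chain_series_nth_0[of odd x "2 * N"] by simp
  fix j
  show "((1 + fps_X) * Abs_fps (\<lambda>k. if k < n then hook_sum x N n (Suc k) else 0)) $ j
      = Abs_fps (\<lambda>j. if j \<le> n then schur_q x N $ j * schur_q x N $ (n - j) else 0) $ j"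
  proof (cases j)
    case 0
    then show ?thesis using hook_sum_first[OF assms] assms q0 by (simp add: distrib_right)
  next
    case (Suc i)
    then show ?thesis
      using hook_sum_add[of j n x N] hook_sum_last[OF assms, of x N] q0
      by (cases j n rule: linorder_cases) (simp_all add: distrib_right add.commute)
  qed
qed

section \<open>Monomial coefficients of the hook sums\<close>

definition word_content :: "nat list \<Rightarrow> nat \<Rightarrow> nat" where
  "word_content w i = length (filter (\<lambda>m. m div 2 = i) w)"

text \<open>A finite index set for monomials. An exponent vector of finite support and degree
  \<open>n\<close> lies in it as soon as \<open>N\<close> is large.\<close>

definition contents :: "nat \<Rightarrow> nat \<Rightarrow> (nat \<Rightarrow> nat) set" where
  "contents N n = {a. (\<forall>i\<ge>N. a i = 0) \<and> (\<Sum>i<N. a i) = n}"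

lemma finite_contents: "finite (contents N n)"
proof (rule finite_subset)
  show "contents N n \<subseteq> {a. \<forall>i. (i \<in> {..<N} \<longrightarrow> a i \<in> {..n}) \<and> (i \<notin> {..<N} \<longrightarrow> a i = 0)}"
    by (auto simp: contents_def intro: member_le_sum)
  show "finite {a :: nat \<Rightarrow> nat. \<forall>i. (i \<in> {..<N} \<longrightarrow> a i \<in> {..n}) \<and> (i \<notin> {..<N} \<longrightarrow> a i = 0)}"
    by (rule finite_set_of_finite_funs) auto
qed

lemma weight_eq_monomial:
  "set w \<subseteq> {..<2 * N} \<Longrightarrow> weight x w = (\<Prod>i<N. x i ^ word_content w i)"
proof (induction w)
  case (Cons m w)
  have "(\<Prod>i<N. x i ^ word_content (m # w) i)
      = (\<Prod>i<N. (if i = m div 2 then x i else 1) * x i ^ word_content w i)"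
    by (rule prod.cong) (auto simp: word_content_def)
  also have "\<dots> = x (m div 2) * (\<Prod>i<N. x i ^ word_content w i)"
    using Cons.prems by (subst prod.distrib) (auto simp: prod.delta)
  finally show ?case using Cons by simp
qed (simp add: word_content_def)

lemma sum_word_content: "set w \<subseteq> {..<2 * N} \<Longrightarrow> (\<Sum>i<N. word_content w i) = length w"
proof (induction w)
  case (Cons m w)
  have "(\<Sum>i<N. word_content (m # w) i)
      = (\<Sum>i<N. (if i = m div 2 then 1 else 0) + word_content w i)"
    by (rule sum.cong) (auto simp: word_content_def)
  also have "\<dots> = 1 + (\<Sum>i<N. word_content w i)"
    using Cons.prems by (subst sum.distrib) (auto simp: sum.delta)
  finally show ?case using Cons by simp
qed (simp add: word_content_def)

lemma word_content_bound:
  assumes "\<forall>i\<ge>N. word_content w i = 0" shows "set w \<subseteq> {..<2 * N}"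
proof
  fix m assume "m \<in> set w"
  then have "word_content w (m div 2) \<noteq> 0" by (auto simp: word_content_def filter_empty_conv)
  then have "m div 2 < N" using assms by (meson not_less)
  then show "m \<in> {..<2 * N}" by auto
qed

lemma hook_sum_monomials:
  "hook_sum x N n k = (\<Sum>a\<in>contents N n.
     real (card {w \<in> hook_words n k. word_content w = a}) * (\<Prod>i<N. x i ^ a i))"
proof -
  let ?W = "{w. w \<in> hook_words n k \<and> set w \<subseteq> {..<2 * N}}"
  have "word_content ` ?W \<subseteq> contents N n"
  proof clarify
    fix w assume w: "w \<in> hook_words n k" "set w \<subseteq> {..<2 * N}"
    have "word_content w i = 0" if "i \<ge> N" for i
      using w(2) that by (auto simp: word_content_def filter_empty_conv subset_iff)
    moreover have "length w = n" using w(1) by (simp add: hook_words_def)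
    ultimately show "word_content w \<in> contents N n"
      using sum_word_content[OF w(2)] by (simp add: contents_def)
  qed
  then have "hook_sum x N n k = (\<Sum>a\<in>contents N n. \<Sum>w | w \<in> ?W \<and> word_content w = a. weight x w)"
    unfolding hook_sum_def by (rule sum.group[OF finite_words finite_contents, symmetric])
  also have "\<dots> = (\<Sum>a\<in>contents N n.
     real (card {w \<in> hook_words n k. word_content w = a}) * (\<Prod>i<N. x i ^ a i))"
  proof (rule sum.cong[OF refl])
    fix a assume a: "a \<in> contents N n"
    then have "{w. w \<in> ?W \<and> word_content w = a} = {w \<in> hook_words n k. word_content w = a}"
      using word_content_bound[of N] by (auto simp: contents_def subset_iff)
    moreover have "(\<Sum>w | w \<in> ?W \<and> word_content w = a. weight x w)
        = (\<Sum>w | w \<in> ?W \<and> word_content w = a. \<Prod>i<N. x i ^ a i)"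
      by (rule sum.cong[OF refl]) (auto simp: weight_eq_monomial)
    ultimately show "(\<Sum>w | w \<in> ?W \<and> word_content w = a. weight x w)
        = real (card {w \<in> hook_words n k. word_content w = a}) * (\<Prod>i<N. x i ^ a i)"
      by simp
  qed
  finally show ?thesis .
qed

text \<open>The boxes of the hook are read along the row from left to right and then up the column.\<close>

definition hook_box :: "nat \<Rightarrow> nat \<Rightarrow> nat \<Rightarrow> nat \<times> nat" where
  "hook_box n k i = (k - 1 - (i - (n - k)), min i (n - k))"

lemma triangle_boxes:
  assumes "1 \<le> k" "k \<le> n"
  shows "triangle n k = {(r, c). r = k - 1 \<and> c \<le> n - k \<or> r < k \<and> c = n - k}"
proof -
  let ?al = "replicate (k - 1) 1 @ [n - k + 1]"
  have len: "length ?al = k" using assms by simp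
  have left: "ribbon_left ?al r = (if r = k - 1 then 0 else n - k)" if "r < k" for r
  proof (cases "r = k - 1")
    case True
    then have "{r<..<k} = {}" by auto
    then show ?thesis using True by (simp add: ribbon_left_def len)
  next
    case False
    then have "{r<..<k} = insert (k - 1) {r<..<k - 1}" using that by auto
    moreover have "(\<Sum>j\<in>{r<..<k - 1}. ?al ! j - 1) = 0"
      by (auto simp: nth_append)
    ultimately show ?thesis using False
      unfolding ribbon_left_def len by (simp add: nth_append)
  qed
  have nth: "?al ! r = (if r = k - 1 then n - k + 1 else 1)" if "r < k" for r
    using that by (auto simp: nth_append)
  show ?thesis
    unfolding triangle_def ribbon_def len
    using assms left nth by (auto split: if_splits)
qed

lemma bij_betw_hook_box:
  assumes "1 \<le> k" "k \<le> n"
  shows "bij_betw (hook_box n k) {..<n} (triangle n k)"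
proof (rule bij_betw_byWitness[where f' = "\<lambda>(r, c). c + (k - 1 - r)"])
  show "hook_box n k ` {..<n} \<subseteq> triangle n k"
    using assms by (auto simp: triangle_boxes hook_box_def min_def split: if_splits)
qed (use assms in \<open>auto simp: triangle_boxes hook_box_def min_def split: if_splits\<close>)

text \<open>Weak increase and the ban on certain repetitions merge into one comparison of ordered
  pairs. The bans in \<open>valid_filling\<close> are symmetric in the two boxes, so they reduce to
  i < j.\<close>

lemma valid_filling_iff_steps:
  "valid_filling D T \<longleftrightarrow>
     (\<forall>r c c'. (r, c) \<in> D \<longrightarrow> (r, c') \<in> D \<longrightarrow> c < c' \<longrightarrow> row_step (T (r, c)) (T (r, c'))) \<and>
     (\<forall>r r' c. (r, c) \<in> D \<longrightarrow> (r', c) \<in> D \<longrightarrow> r < r' \<longrightarrow> column_step (T (r', c)) (T (r, c)))"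
proof -
  have step: "step P y z \<longleftrightarrow> y \<le> z \<and> (\<not> P y \<longrightarrow> y \<noteq> z)" for P y z
    by (auto simp: step_def)
  have line: "(\<forall>i j. B i \<longrightarrow> B j \<longrightarrow> i < j \<longrightarrow> step P (f i) (f j)) \<longleftrightarrow>
      (\<forall>i j. B i \<longrightarrow> B j \<longrightarrow> i < j \<longrightarrow> f i \<le> f j) \<and>
      (\<forall>i j. B i \<longrightarrow> B j \<longrightarrow> i \<noteq> j \<longrightarrow> \<not> P (f i) \<longrightarrow> f i \<noteq> f j)"
    for B :: "nat \<Rightarrow> bool" and P f
    unfolding step
  proof (intro iffI conjI allI impI)
    fix i j
    assume *: "\<forall>i j. B i \<longrightarrow> B j \<longrightarrow> i < j \<longrightarrow> f i \<le> f j \<and> (\<not> P (f i) \<longrightarrow> f i \<noteq> f j)"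
      and ij: "B i" "B j" "i \<noteq> j" "\<not> P (f i)"
    show "f i \<noteq> f j"
      using * ij by (cases i j rule: linorder_cases) metis+
  qed auto
  have rows: "(\<forall>c c'. (r, c) \<in> D \<longrightarrow> (r, c') \<in> D \<longrightarrow> c < c' \<longrightarrow> row_step (T (r, c)) (T (r, c'))) \<longleftrightarrow>
      (\<forall>c c'. (r, c) \<in> D \<longrightarrow> (r, c') \<in> D \<longrightarrow> c < c' \<longrightarrow> T (r, c) \<le> T (r, c')) \<and>
      (\<forall>c c'. (r, c) \<in> D \<longrightarrow> (r, c') \<in> D \<longrightarrow> c \<noteq> c' \<longrightarrow> even (T (r, c)) \<longrightarrow> T (r, c) \<noteq> T (r, c'))"
    for r
    using line[of "\<lambda>c. (r, c) \<in> D" odd "\<lambda>c. T (r, c)"] by simp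
  have columns: "(\<forall>r r'. (r, c) \<in> D \<longrightarrow> (r', c) \<in> D \<longrightarrow> r < r' \<longrightarrow> column_step (T (r', c)) (T (r, c))) \<longleftrightarrow>
      (\<forall>r r'. (r, c) \<in> D \<longrightarrow> (r', c) \<in> D \<longrightarrow> r < r' \<longrightarrow> T (r, c) \<le> T (r', c)) \<and>
      (\<forall>r r'. (r, c) \<in> D \<longrightarrow> (r', c) \<in> D \<longrightarrow> r \<noteq> r' \<longrightarrow> odd (T (r, c)) \<longrightarrow> T (r, c) \<noteq> T (r', c))"
    for c
    using line[of "\<lambda>r. (r, c) \<in> D" even "\<lambda>r. T (r, c)"] by simp
  have swap: "(\<forall>r r' c. (r, c) \<in> D \<longrightarrow> (r', c) \<in> D \<longrightarrow> r < r' \<longrightarrow> column_step (T (r', c)) (T (r, c))) \<longleftrightarrow>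
      (\<forall>c r r'. (r, c) \<in> D \<longrightarrow> (r', c) \<in> D \<longrightarrow> r < r' \<longrightarrow> column_step (T (r', c)) (T (r, c)))"
    by blast
  show ?thesis
    unfolding valid_filling_def swap rows columns all_conj_distrib by blast
qed

lemma valid_filling_iff:
  assumes nk: "1 \<le> k" "k \<le> n" and w: "length w = n" "\<And>i. i < n \<Longrightarrow> T (hook_box n k i) = w ! i"
  shows "valid_filling (triangle n k) T \<longleftrightarrow> w \<in> hook_words n k"
proof -
  let ?D = "triangle n k"
  have row: "T (k - 1, c) = w ! c" if "c \<le> n - k" for c
    using w(2)[of c] that nk by (simp add: hook_box_def)
  \<comment> \<open>The column is read upwards from the bottom, so the box in row \<open>r\<close>
    has position n - 1 - r.\<close>
  have col: "T (r, n - k) = w ! (n - Suc r)" if "r < k" for r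
    using w(2)[of "n - Suc r"] that nk by (simp add: hook_box_def Suc_diff_Suc)
  have "valid_filling ?D T \<longleftrightarrow>
     (\<forall>r c c'. (r, c) \<in> ?D \<longrightarrow> (r, c') \<in> ?D \<longrightarrow> c < c' \<longrightarrow> row_step (T (r, c)) (T (r, c'))) \<and>
     (\<forall>r r' c. (r, c) \<in> ?D \<longrightarrow> (r', c) \<in> ?D \<longrightarrow> r < r' \<longrightarrow> column_step (T (r', c)) (T (r, c)))"
    by (rule valid_filling_iff_steps)
  also have "(\<forall>r c c'. (r, c) \<in> ?D \<longrightarrow> (r, c') \<in> ?D \<longrightarrow> c < c' \<longrightarrow> row_step (T (r, c)) (T (r, c')))
      \<longleftrightarrow> (\<forall>c c'. c' \<le> n - k \<longrightarrow> c < c' \<longrightarrow> row_step (w ! c) (w ! c'))"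
  proof -
    have "(\<forall>r c c'. (r, c) \<in> ?D \<longrightarrow> (r, c') \<in> ?D \<longrightarrow> c < c' \<longrightarrow> row_step (T (r, c)) (T (r, c')))
      \<longleftrightarrow> (\<forall>c c'. c' \<le> n - k \<longrightarrow> c < c' \<longrightarrow> row_step (T (k - 1, c)) (T (k - 1, c')))"
      using nk by (auto simp: triangle_boxes)
    then show ?thesis using row by simp
  qed
  also have "(\<forall>r r' c. (r, c) \<in> ?D \<longrightarrow> (r', c) \<in> ?D \<longrightarrow> r < r' \<longrightarrow> column_step (T (r', c)) (T (r, c)))
      \<longleftrightarrow> (\<forall>r r'. r' < k \<longrightarrow> r < r' \<longrightarrow> column_step (w ! (n - Suc r')) (w ! (n - Suc r)))"
  proof -
    have "(\<forall>r r' c. (r, c) \<in> ?D \<longrightarrow> (r', c) \<in> ?D \<longrightarrow> r < r' \<longrightarrow> column_step (T (r', c)) (T (r, c)))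
      \<longleftrightarrow> (\<forall>r r'. r' < k \<longrightarrow> r < r' \<longrightarrow> column_step (T (r', n - k)) (T (r, n - k)))"
      using nk by (auto simp: triangle_boxes)
    then show ?thesis using col by simp
  qed
  also have "(\<forall>c c'. c' \<le> n - k \<longrightarrow> c < c' \<longrightarrow> row_step (w ! c) (w ! c'))
      \<longleftrightarrow> sorted_wrt row_step (take (Suc (n - k)) w)"
    using nk w(1) by (auto simp: sorted_wrt_iff_nth_less less_Suc_eq_le)
  also have "(\<forall>r r'. r' < k \<longrightarrow> r < r' \<longrightarrow> column_step (w ! (n - Suc r')) (w ! (n - Suc r)))
      \<longleftrightarrow> sorted_wrt column_step (drop (n - k) w)" (is "?A \<longleftrightarrow> ?B")
  proof
    assume A: ?A
    show ?B unfolding sorted_wrt_iff_nth_less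
    proof (intro allI impI)
      fix i j assume ij: "i < j" "j < length (drop (n - k) w)"
      then have j: "j < k" using w(1) nk by simp
      then have "n - Suc (k - Suc i) = n - k + i" "n - Suc (k - Suc j) = n - k + j"
        using ij nk by simp_all
      moreover have "column_step (w ! (n - Suc (k - Suc i))) (w ! (n - Suc (k - Suc j)))"
        by (rule A[rule_format]) (use ij j in auto)
      ultimately show "column_step (drop (n - k) w ! i) (drop (n - k) w ! j)"
        using ij w(1) nk by simp
    qed
  next
    assume B: ?B
    show ?A
    proof (intro allI impI)
      fix r r' assume r: "r' < k" "r < r'"
      then have "n - k + (k - Suc r) = n - Suc r" "n - k + (k - Suc r') = n - Suc r'"
        using nk by simp_all
      moreover have "column_step (drop (n - k) w ! (k - Suc r')) (drop (n - k) w ! (k - Suc r))"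
        by (rule B[unfolded sorted_wrt_iff_nth_less, rule_format]) (use r nk w(1) in auto)
      ultimately show "column_step (w ! (n - Suc r')) (w ! (n - Suc r))"
        using nk w(1) by simp
    qed
  qed
  finally show ?thesis using w(1) by (simp add: hook_words_def)
qed

lemma rcoef_triangle:
  assumes "1 \<le> k" "k \<le> n"
  shows "rcoef (triangle n k) a = card {w \<in> hook_words n k. word_content w = a}"
proof -
  let ?D = "triangle n k" and ?b = "hook_box n k"
  let ?F = "{T. (\<forall>b. b \<notin> ?D \<longrightarrow> T b = 0) \<and> valid_filling ?D T \<and> content ?D T = a}"
  let ?W = "{w \<in> hook_words n k. word_content w = a}"
  let ?w = "\<lambda>T. map (\<lambda>i. T (?b i)) [0..<n]"
  \<comment> \<open>The value 0 off \<open>?D\<close> matches the extensional fillings counted by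
    \<open>rcoef\<close>; without it the inverse would not be unique.\<close>
  let ?T = "\<lambda>w b. if b \<in> ?D then w ! inv_into {..<n} ?b b else 0"
  have bij: "bij_betw ?b {..<n} ?D" by (rule bij_betw_hook_box[OF assms])
  then have inj: "inj_on ?b {..<n}" and img: "?b ` {..<n} = ?D" by (auto simp: bij_betw_def)
  have cont: "content ?D T = word_content w"
    if "length w = n" "\<And>i. i < n \<Longrightarrow> T (?b i) = w ! i" for w T
  proof
    fix v
    have "{b \<in> ?D. T b div 2 = v} = ?b ` {i. i < n \<and> w ! i div 2 = v}"
      unfolding img[symmetric] using that(2) by auto
    moreover have "inj_on ?b {i. i < n \<and> w ! i div 2 = v}"
      by (rule inj_on_subset[OF inj]) auto
    ultimately show "content ?D T v = word_content w v"
      by (simp add: content_def word_content_def length_filter_conv_card card_image that(1))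
  qed
  have "bij_betw ?w ?F ?W"
  proof (rule bij_betw_byWitness[where f' = ?T])
    show "\<forall>T\<in>?F. ?T (?w T) = T"
    proof (intro ballI ext)
      fix T b assume T: "T \<in> ?F"
      show "?T (?w T) b = T b"
      proof (cases "b \<in> ?D")
        case True
        then have "inv_into {..<n} ?b b < n" "?b (inv_into {..<n} ?b b) = b"
          using img by (metis inv_into_into lessThan_iff, metis f_inv_into_f)
        then show ?thesis using True by simp
      next
        case False
        then show ?thesis using T by (cases b) auto
      qed
    qed
    have mem: "?b i \<in> ?D" and inv: "inv_into {..<n} ?b (?b i) = i" if "i < n" for i
      using that img by (auto simp: inv_into_f_f[OF inj])
    then have Tb: "?T w (?b i) = w ! i" if "i < n" for w :: "nat list" and i
      using that by simp
    show "\<forall>w\<in>?W. ?w (?T w) = w"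
    proof
      fix w assume "w \<in> ?W"
      then have "length w = n" by (auto simp: hook_words_def)
      then show "?w (?T w) = w" by (intro nth_equalityI) (simp_all add: mem inv)
    qed
    show "?w ` ?F \<subseteq> ?W"
    proof (rule image_subsetI)
      fix T assume T: "T \<in> ?F"
      have "valid_filling ?D T \<longleftrightarrow> ?w T \<in> hook_words n k"
        by (rule valid_filling_iff[OF assms]) auto
      moreover have "content ?D T = word_content (?w T)"
        by (rule cont) auto
      ultimately show "?w T \<in> ?W" using T by simp
    qed
    show "?T ` ?W \<subseteq> ?F"
    proof (rule image_subsetI)
      fix w assume w: "w \<in> ?W"
      then have len: "length w = n" by (auto simp: hook_words_def)
      have "valid_filling ?D (?T w) \<longleftrightarrow> w \<in> hook_words n k"
        by (rule valid_filling_iff[OF assms len Tb])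
      moreover have "content ?D (?T w) = word_content w"
        by (rule cont[OF len Tb])
      ultimately show "?T w \<in> ?F" using w by simp
    qed
  qed
  then show ?thesis unfolding rcoef_def by (rule bij_betw_same_card)
qed

section \<open>Power sum expansion\<close>

definition odd_partitions :: "nat \<Rightarrow> nat multiset set" where
  "odd_partitions n = {mu. (\<forall>m\<in>#mu. odd m) \<and> sum_mset mu = n}"

lemma finite_odd_partitions: "finite (odd_partitions n)"
proof (induction n rule: less_induct)
  case (less n)
  have "odd_partitions n \<subseteq> {{#}} \<union> (\<Union>m\<in>{m. odd m \<and> m \<le> n}. add_mset m ` odd_partitions (n - m))"
  proof
    fix mu assume mu: "mu \<in> odd_partitions n"
    show "mu \<in> {{#}} \<union> (\<Union>m\<in>{m. odd m \<and> m \<le> n}. add_mset m ` odd_partitions (n - m))"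
      using mu by (cases mu) (auto simp: odd_partitions_def)
  qed
  moreover have "finite (odd_partitions (n - m))" if "odd m" "m \<le> n" for m
    using that by (intro less) (auto elim: oddE)
  ultimately show ?case by (auto intro: finite_subset)
qed

text \<open>This is $2^{\ell(\mu)} / z_\mu$.\<close>

definition odd_weight :: "nat multiset \<Rightarrow> real" where
  "odd_weight mu = (\<Prod>m\<in>set_mset mu. 2 ^ count mu m / (real m ^ count mu m * fact (count mu m)))"

text \<open>Adding a part \<open>m\<close> multiplies z_mu by m times the new multiplicity of m, and
  2^l by 2.\<close>

lemma odd_weight_add_mset:
  assumes "m > 0"
  shows "odd_weight (add_mset m nu) * (real m * real (count (add_mset m nu) m)) = 2 * odd_weight nu"
proof -
  let ?f = "\<lambda>mu m. 2 ^ count mu m / (real m ^ count mu m * fact (count mu m))"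
  let ?S = "set_mset nu - {m}"
  have ins: "(\<Prod>i\<in>insert m ?S. g i) = g m * (\<Prod>i\<in>?S. g i)" for g :: "nat \<Rightarrow> real"
    by (rule prod.insert) auto
  have "odd_weight nu = (\<Prod>i\<in>insert m ?S. ?f nu i)"
    unfolding odd_weight_def by (rule prod.mono_neutral_left) (auto simp: not_in_iff)
  then have nu: "odd_weight nu = ?f nu m * (\<Prod>i\<in>?S. ?f nu i)"
    by (simp only: ins)
  have "odd_weight (add_mset m nu) = (\<Prod>i\<in>insert m ?S. ?f (add_mset m nu) i)"
    unfolding odd_weight_def by (rule prod.cong) auto
  also have "\<dots> = ?f (add_mset m nu) m * (\<Prod>i\<in>?S. ?f (add_mset m nu) i)"
    by (rule ins)
  also have "(\<Prod>i\<in>?S. ?f (add_mset m nu) i) = (\<Prod>i\<in>?S. ?f nu i)"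
    by (rule prod.cong) auto
  finally have add: "odd_weight (add_mset m nu) = ?f (add_mset m nu) m * (\<Prod>i\<in>?S. ?f nu i)" .
  have "?f (add_mset m nu) m * (real m * real (count (add_mset m nu) m)) = 2 * ?f nu m"
    using assms by (simp add: divide_simps)
  from arg_cong[OF this, of "\<lambda>z. z * (\<Prod>i\<in>?S. ?f nu i)"] show ?thesis
    unfolding nu add by (simp only: mult_ac)
qed

lemma odd_weight_pos:
  assumes "mu \<in> odd_partitions n" shows "odd_weight mu > 0"
  unfolding odd_weight_def
proof (rule prod_pos)
  fix m assume "m \<in> set_mset mu"
  then have "m > 0" using assms by (auto simp: odd_partitions_def intro: odd_pos)
  then show "0 < (2 :: real) ^ count mu m / (real m ^ count mu m * fact (count mu m))" by simp
qed

lemma sum_mset_eq_sum_count: "sum_mset mu = (\<Sum>m\<in>set_mset mu. m * count mu m)"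
proof (induction mu)
  case (add x mu)
  have "(\<Sum>m\<in>set_mset (add_mset x mu). m * count (add_mset x mu) m)
      = (\<Sum>m\<in>insert x (set_mset mu). (if m = x then x else 0) + m * count mu m)"
    by (rule sum.cong) auto
  also have "\<dots> = x + (\<Sum>m\<in>insert x (set_mset mu). m * count mu m)"
    by (subst sum.distrib) (simp add: sum.delta)
  also have "(\<Sum>m\<in>insert x (set_mset mu). m * count mu m) = (\<Sum>m\<in>set_mset mu. m * count mu m)"
    by (rule sum.mono_neutral_right) (auto simp: not_in_iff)
  finally show ?case using add by simp
qed simp

text \<open>The coefficient at u^j counts the sets of parts with sum j, equal parts being
  distinguished.\<close>

definition subset_sums :: "nat multiset \<Rightarrow> real fps" where
  "subset_sums mu = (\<Prod>m\<in>#mu. 1 + fps_X ^ m)"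

definition power_sums :: "(nat \<Rightarrow> real) \<Rightarrow> nat \<Rightarrow> nat multiset \<Rightarrow> real" where
  "power_sums x N mu = (\<Prod>m\<in>#mu. power_sum x N m)"

text \<open>With Q the series of the q_j, this is the coefficient of t^n in Q(ut) Q(t), a polynomial
  in u.\<close>

definition q_products :: "(nat \<Rightarrow> real) \<Rightarrow> nat \<Rightarrow> nat \<Rightarrow> real fps" where
  "q_products x N n = Abs_fps (\<lambda>j. if j \<le> n then schur_q x N $ j * schur_q x N $ (n - j) else 0)"

text \<open>The operator t d/dt applied to Q(ut) Q(t). Coefficientwise, n = j + (n - j) and
  \<open>schur_q_newton\<close> is applied to each factor; a part m taken from q_j lowers the power
  of u and accounts for u^m, one taken from q_(n-j) accounts for 1.\<close>

lemma q_products_newton: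
  "fps_const (real n) * q_products x N n
    = (\<Sum>m | odd m \<and> m \<le> n. fps_const (2 * power_sum x N m) * ((1 + fps_X ^ m) * q_products x N (n - m)))"
proof (rule fps_ext)
  fix j
  let ?q = "\<lambda>j. schur_q x N $ j" and ?p = "\<lambda>m. power_sum x N m"
  let ?G = "\<lambda>n j. if j \<le> n then ?q j * ?q (n - j) else 0"
  have rhs: "(\<Sum>m | odd m \<and> m \<le> n. fps_const (2 * ?p m) * ((1 + fps_X ^ m) * q_products x N (n - m))) $ j
    = (\<Sum>m | odd m \<and> m \<le> n. 2 * ?p m * (?G (n - m) j + (if m \<le> j then ?G (n - m) (j - m) else 0)))"
    unfolding fps_sum_nth
    by (rule sum.cong)
      (auto simp: q_products_def distrib_right fps_X_power_mult_nth simp flip: not_less)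
  have lhs: "(fps_const (real n) * q_products x N n) $ j = real n * ?G n j"
    by (simp add: q_products_def)
  show "(fps_const (real n) * q_products x N n) $ j
      = (\<Sum>m | odd m \<and> m \<le> n. fps_const (2 * ?p m) * ((1 + fps_X ^ m) * q_products x N (n - m))) $ j"
  proof (cases "j \<le> n")
    case False
    then show ?thesis unfolding rhs lhs by (auto intro!: sum.neutral)
  next
    case True
    have "real n * ?G n j = (real j * ?q j) * ?q (n - j) + ?q j * (real (n - j) * ?q (n - j))"
      using True by (simp add: algebra_simps of_nat_diff)
    also have "\<dots> = (\<Sum>m | odd m \<and> m \<le> j. 2 * ?p m * (?q (j - m) * ?q (n - j)))
        + (\<Sum>m | odd m \<and> m \<le> n - j. 2 * ?p m * (?q j * ?q (n - j - m)))"
      unfolding schur_q_newton by (simp add: sum_distrib_left sum_distrib_right mult_ac)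
    also have "(\<Sum>m | odd m \<and> m \<le> j. 2 * ?p m * (?q (j - m) * ?q (n - j)))
        = (\<Sum>m | odd m \<and> m \<le> n. 2 * ?p m * (if m \<le> j then ?G (n - m) (j - m) else 0))"
      by (rule sum.mono_neutral_cong_left) (use True in auto)
    also have "(\<Sum>m | odd m \<and> m \<le> n - j. 2 * ?p m * (?q j * ?q (n - j - m)))
        = (\<Sum>m | odd m \<and> m \<le> n. 2 * ?p m * ?G (n - m) j)"
      by (rule sum.mono_neutral_cong_left) (use True in \<open>auto simp: diff_commute add.commute\<close>)
    also have "(\<Sum>m | odd m \<and> m \<le> n. 2 * ?p m * (if m \<le> j then ?G (n - m) (j - m) else 0))
        + (\<Sum>m | odd m \<and> m \<le> n. 2 * ?p m * ?G (n - m) j)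
      = (\<Sum>m | odd m \<and> m \<le> n. 2 * ?p m * (?G (n - m) j + (if m \<le> j then ?G (n - m) (j - m) else 0)))"
      unfolding sum.distrib[symmetric] by (rule sum.cong) (simp_all add: distrib_left)
    finally show ?thesis unfolding rhs lhs .
  qed
qed

text \<open>Double counting of pairs of a partition and one of its part sizes.
  \<open>set_mset\<close> lists each size once, so multiplicities have to enter through
  \<open>f\<close>.\<close>

lemma sum_remove_part:
  fixes f :: "nat multiset \<Rightarrow> nat \<Rightarrow> 'a :: comm_monoid_add"
  shows "(\<Sum>m | odd m \<and> m \<le> n. \<Sum>nu\<in>odd_partitions (n - m). f (add_mset m nu) m)
    = (\<Sum>mu\<in>odd_partitions n. \<Sum>m\<in>set_mset mu. f mu m)"
proof -
  let ?M = "{m. odd m \<and> m \<le> n}"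
  let ?A = "SIGMA m:?M. odd_partitions (n - m)" and ?B = "SIGMA mu:odd_partitions n. set_mset mu"
  have "(\<Sum>m\<in>?M. \<Sum>nu\<in>odd_partitions (n - m). f (add_mset m nu) m)
      = (\<Sum>(m, nu)\<in>?A. f (add_mset m nu) m)"
    by (rule sum.Sigma) (auto simp: finite_odd_partitions)
  also have "\<dots> = (\<Sum>(mu, m)\<in>?B. f mu m)"
  proof (rule sum.reindex_bij_witness[of _ "\<lambda>(mu, m). (m, mu - {#m#})" "\<lambda>(m, nu). (add_mset m nu, m)"])
    fix b assume "b \<in> ?B"
    then obtain mu m where b: "b = (mu, m)" "mu \<in> odd_partitions n" "m \<in># mu" by auto
    from multi_member_split[OF b(3)] obtain nu where mu: "mu = add_mset m nu" ..
    have "odd m" "\<forall>x\<in>#nu. odd x" and n: "n = m + sum_mset nu"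
      using b(2) by (simp_all add: mu odd_partitions_def)
    then have "odd m" "m \<le> n" "nu \<in> odd_partitions (n - m)"
      by (simp_all add: n odd_partitions_def)
    then show "(case b of (mu, m) \<Rightarrow> (m, mu - {#m#})) \<in> ?A"
      unfolding b(1) mu by simp
  next
    fix b assume "b \<in> ?A"
    then obtain m nu where b: "b = (m, nu)" and m: "odd m" "m \<le> n" and nu: "nu \<in> odd_partitions (n - m)"
      by blast
    then have "add_mset m nu \<in> odd_partitions n"
      by (simp add: odd_partitions_def)
    then show "(case b of (m, nu) \<Rightarrow> (add_mset m nu, m)) \<in> ?B"
      by (simp add: b)
  next
    fix b assume "b \<in> ?B"
    then show "(case case b of (mu, m) \<Rightarrow> (m, mu - {#m#}) of (m, nu) \<Rightarrow> (add_mset m nu, m)) = b"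
      by (cases b) simp
  next
    fix b assume "b \<in> ?A"
    then show "(case case b of (m, nu) \<Rightarrow> (add_mset m nu, m) of (mu, m) \<Rightarrow> (m, mu - {#m#})) = b"
      by (cases b) simp
    show "(case case b of (m, nu) \<Rightarrow> (add_mset m nu, m) of (mu, m) \<Rightarrow> f mu m)
        = (case b of (m, nu) \<Rightarrow> f (add_mset m nu) m)"
      by (cases b) simp
  qed
  also have "\<dots> = (\<Sum>mu\<in>odd_partitions n. \<Sum>m\<in>set_mset mu. f mu m)"
    by (rule sum.Sigma[symmetric]) (auto simp: finite_odd_partitions)
  finally show ?thesis .
qed

text \<open>Induction along \<open>q_products_newton\<close>. Each term there belongs to a partition
  with a chosen part size m and carries the weight m times its multiplicity; over all sizes these
  weights add up to n, which cancels.\<close>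

lemma q_products_expansion:
  "q_products x N n = (\<Sum>mu\<in>odd_partitions n.
     fps_const (odd_weight mu * power_sums x N mu) * subset_sums mu)"
proof (induction n rule: less_induct)
  case (less n)
  let ?t = "\<lambda>mu. fps_const (odd_weight mu * power_sums x N mu) * subset_sums mu"
  show ?case
  proof (cases "n = 0")
    case True
    have "mu = {#}" if "mu \<in> odd_partitions 0" for mu
      using that by (cases mu) (auto simp: odd_partitions_def)
    then have "odd_partitions 0 = {{#}}"
      by (auto simp: odd_partitions_def)
    moreover have "schur_q x N $ 0 = 1"
      using chain_series_eq_schur_q[of odd False x N] chain_series_nth_0[of odd x "2 * N"] by simp
    then have "q_products x N 0 = 1"
      by (intro fps_ext) (auto simp: q_products_def)
    ultimately show ?thesis
      using True by (simp add: odd_weight_def power_sums_def subset_sums_def)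
  next
    case False
    let ?M = "{m. odd m \<and> m \<le> n}"
    let ?c = "\<lambda>mu m. fps_const (real m * real (count mu m)) * ?t mu"
    have "fps_const (real n) * q_products x N n
        = (\<Sum>m\<in>?M. \<Sum>nu\<in>odd_partitions (n - m). ?c (add_mset m nu) m)"
      unfolding q_products_newton
    proof (rule sum.cong[OF refl])
      fix m assume m: "m \<in> ?M"
      then have "m > 0" by (auto intro: odd_pos)
      then have ih: "q_products x N (n - m) = (\<Sum>nu\<in>odd_partitions (n - m). ?t nu)"
        using False by (intro less) simp
      have "fps_const (2 * power_sum x N m) * ((1 + fps_X ^ m) * ?t nu) = ?c (add_mset m nu) m" for nu
      proof -
        have "fps_const (2 * power_sum x N m) * ((1 + fps_X ^ m) * ?t nu)
            = fps_const (2 * power_sum x N m) * fps_const (odd_weight nu * power_sums x N nu) *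
              subset_sums (add_mset m nu)"
          by (simp add: subset_sums_def mult_ac del: fps_const_mult)
        also have "fps_const (2 * power_sum x N m) * fps_const (odd_weight nu * power_sums x N nu)
            = fps_const (2 * odd_weight nu * power_sums x N (add_mset m nu))"
          by (simp add: power_sums_def mult_ac)
        also have "\<dots> = fps_const (real m * real (count (add_mset m nu) m)) *
            fps_const (odd_weight (add_mset m nu) * power_sums x N (add_mset m nu))"
          unfolding odd_weight_add_mset[OF \<open>m > 0\<close>, symmetric] by (simp add: mult_ac)
        finally show ?thesis by (simp only: mult.assoc)
      qed
      then show "fps_const (2 * power_sum x N m) * ((1 + fps_X ^ m) * q_products x N (n - m))
          = (\<Sum>nu\<in>odd_partitions (n - m). ?c (add_mset m nu) m)"
        unfolding ih by (simp only: sum_distrib_left)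
    qed
    also have "\<dots> = (\<Sum>mu\<in>odd_partitions n. \<Sum>m\<in>set_mset mu. ?c mu m)"
      by (rule sum_remove_part)
    also have "\<dots> = (\<Sum>mu\<in>odd_partitions n. fps_const (real n) * ?t mu)"
    proof (rule sum.cong[OF refl])
      fix mu assume "mu \<in> odd_partitions n"
      then have "n = (\<Sum>m\<in>set_mset mu. m * count mu m)"
        by (simp add: odd_partitions_def sum_mset_eq_sum_count)
      then have "real n = (\<Sum>m\<in>set_mset mu. real m * real (count mu m))"
        by simp
      then show "(\<Sum>m\<in>set_mset mu. ?c mu m) = fps_const (real n) * ?t mu"
        by (intro fps_ext) (simp add: fps_sum_nth sum_distrib_right mult.assoc)
    qed
    finally have "fps_const (real n) * q_products x N n
        = fps_const (real n) * (\<Sum>mu\<in>odd_partitions n. ?t mu)"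
      by (simp only: sum_distrib_left)
    moreover have "fps_const (real n) \<noteq> 0" using False by simp
    ultimately show ?thesis by (simp only: mult_left_cancel simp_thms)
  qed
qed

text \<open>The polynomial A_mu, taken as a power series so that computation part by part can start
  at the empty partition, where it is 1/(1 + u).\<close>

definition alternating_sums :: "nat multiset \<Rightarrow> real fps" where
  "alternating_sums mu = inverse (1 + fps_X) * subset_sums mu"

lemma one_plus_X_alternating_sums: "(1 + fps_X) * alternating_sums mu = subset_sums mu"
proof -
  have "(1 + fps_X) * inverse (1 + fps_X) = (1 :: real fps)"
    by (rule inverse_mult_eq_1') simp
  then show ?thesis by (simp add: alternating_sums_def flip: mult.assoc)
qed

lemma hook_sum_expansion:
  assumes "1 \<le> k" "k \<le> n"
  shows "hook_sum x N n k = (\<Sum>mu\<in>odd_partitions n.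
     odd_weight mu * alternating_sums mu $ (k - 1) * power_sums x N mu)"
proof -
  let ?T = "Abs_fps (\<lambda>k. if k < n then hook_sum x N n (Suc k) else 0)"
  let ?S = "\<Sum>mu\<in>odd_partitions n. fps_const (odd_weight mu * power_sums x N mu) * alternating_sums mu"
  have "(1 + fps_X) * ?T = q_products x N n"
    using hook_series[of n x N] assms by (simp add: q_products_def)
  also have "\<dots> = (1 + fps_X) * ?S"
    unfolding q_products_expansion sum_distrib_left
    by (rule sum.cong[OF refl]) (metis mult.left_commute one_plus_X_alternating_sums)
  finally have eq: "(1 + fps_X) * ?T = (1 + fps_X) * ?S" .
  have "(1 + fps_X :: real fps) $ 0 \<noteq> 0" by simp
  then have "1 + fps_X \<noteq> (0 :: real fps)" by (metis fps_zero_nth)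
  then have "?T = ?S" using eq by (rule mult_left_cancel[THEN iffD1])
  then have "?T $ (k - 1) = ?S $ (k - 1)" by simp
  then show ?thesis using assms by (cases k) (simp_all add: fps_sum_nth mult_ac)
qed

section \<open>Monomials and linear independence of the power sums\<close>

text \<open>The exponent vector of the monomial that arises when the variable with index
  \<open>vs ! i\<close> is picked from the i-th power sum factor.\<close>

definition exponents :: "nat list \<Rightarrow> nat list \<Rightarrow> nat \<Rightarrow> nat" where
  "exponents mu vs j = (\<Sum>i<length mu. if vs ! i = j then mu ! i else 0)"

lemma pcoef_exponents: "pcoef mu a = card {vs. length vs = length mu \<and> exponents mu vs = a}"
  by (simp add: pcoef_def exponents_def fun_eq_iff)

lemma prod_exponents:
  assumes "length vs = length mu" "set vs \<subseteq> {..<N}"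
  shows "(\<Prod>i<length mu. (x (vs ! i) :: real) ^ (mu ! i)) = (\<Prod>j<N. x j ^ exponents mu vs j)"
proof -
  have "(\<Prod>j<N. x j ^ exponents mu vs j)
      = (\<Prod>j<N. \<Prod>i<length mu. if vs ! i = j then x j ^ (mu ! i) else 1)"
    unfolding exponents_def power_sum by (intro prod.cong refl) auto
  also have "\<dots> = (\<Prod>i<length mu. \<Prod>j<N. if vs ! i = j then x j ^ (mu ! i) else 1)"
    by (rule prod.swap)
  also have "\<dots> = (\<Prod>i<length mu. x (vs ! i) ^ (mu ! i))"
  proof (rule prod.cong[OF refl])
    fix i assume "i \<in> {..<length mu}"
    then have "vs ! i \<in> {..<N}" using assms by (metis lessThan_iff nth_mem subsetD)
    then show "(\<Prod>j<N. if vs ! i = j then x j ^ (mu ! i) else 1) = x (vs ! i) ^ (mu ! i)"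
      by (simp add: prod.delta)
  qed
  finally show ?thesis by simp
qed

lemma power_sums_lists:
  "power_sums x N (mset mu)
     = (\<Sum>vs | length vs = length mu \<and> set vs \<subseteq> {..<N}. \<Prod>i<length mu. x (vs ! i) ^ (mu ! i))"
proof (induction mu)
  case Nil
  have "{vs :: nat list. length vs = length [] \<and> set vs \<subseteq> {..<N}} = {[]}" by auto
  then show ?case by (simp add: power_sums_def)
next
  case (Cons m mu)
  let ?L = "{vs. length vs = length mu \<and> set vs \<subseteq> {..<N}}"
  have "(\<Sum>vs | length vs = length (m # mu) \<and> set vs \<subseteq> {..<N}. \<Prod>i<length (m # mu). x (vs ! i) ^ ((m # mu) ! i))
      = (\<Sum>(v, vs)\<in>{..<N} \<times> ?L. x v ^ m * (\<Prod>i<length mu. x (vs ! i) ^ (mu ! i)))"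
  proof (rule sum.reindex_bij_witness[of _ "\<lambda>(v, vs). v # vs" "\<lambda>vs. (hd vs, tl vs)"])
    fix vs assume vs: "vs \<in> {vs. length vs = length (m # mu) \<and> set vs \<subseteq> {..<N}}"
    then obtain v us where "vs = v # us" by (cases vs) auto
    with vs show "(case (hd vs, tl vs) of (v, vs) \<Rightarrow> v # vs) = vs"
      "(hd vs, tl vs) \<in> {..<N} \<times> ?L"
      "(case (hd vs, tl vs) of (v, vs) \<Rightarrow> x v ^ m * (\<Prod>i<length mu. x (vs ! i) ^ (mu ! i)))
        = (\<Prod>i<length (m # mu). x (vs ! i) ^ ((m # mu) ! i))"
      by (auto simp: prod.lessThan_Suc_shift simp del: prod.lessThan_Suc)
  qed auto
  also have "\<dots> = power_sum x N m * power_sums x N (mset mu)"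
    unfolding Cons by (simp add: power_sum_def sum_product sum.cartesian_product)
  finally show ?case by (simp add: power_sums_def)
qed

lemma finite_lists_below: "finite {vs. length vs = l \<and> set vs \<subseteq> {..<N :: nat}}"
  using finite_lists_length_eq[of "{..<N}" l] by (simp add: conj_commute)

lemma exponents_eq_0_iff:
  assumes "0 \<notin> set mu"
  shows "exponents mu vs j = 0 \<longleftrightarrow> (\<forall>i<length mu. vs ! i \<noteq> j)"
proof -
  have pos: "mu ! i \<noteq> 0" if "i < length mu" for i
    using assms that nth_mem by metis
  have "exponents mu vs j = 0 \<longleftrightarrow> (\<forall>i<length mu. vs ! i = j \<longrightarrow> mu ! i = 0)"
    by (auto simp: exponents_def)
  then show ?thesis using pos by metis
qed

lemma exponents_bound:
  assumes "0 \<notin> set mu" "length vs = length mu"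
  shows "(\<forall>j\<ge>N. exponents mu vs j = 0) \<longleftrightarrow> set vs \<subseteq> {..<N}"
proof -
  have "(\<forall>j\<ge>N. exponents mu vs j = 0) \<longleftrightarrow> (\<forall>i<length vs. vs ! i < N)"
    unfolding exponents_eq_0_iff[OF assms(1)] assms(2)[symmetric] by (auto simp: not_le[symmetric])
  then show ?thesis by (auto simp: subset_iff in_set_conv_nth)
qed

lemma sum_exponents:
  assumes "length vs = length mu" "set vs \<subseteq> {..<N}"
  shows "(\<Sum>j<N. exponents mu vs j) = sum_list mu"
proof -
  have "(\<Sum>j<N. exponents mu vs j) = (\<Sum>i<length mu. \<Sum>j<N. if vs ! i = j then mu ! i else 0)"
    unfolding exponents_def by (rule sum.swap)
  also have "\<dots> = (\<Sum>i<length mu. mu ! i)"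
  proof (rule sum.cong[OF refl])
    fix i assume "i \<in> {..<length mu}"
    then have "vs ! i \<in> {..<N}" using assms by (metis lessThan_iff nth_mem subsetD)
    then show "(\<Sum>j<N. if vs ! i = j then mu ! i else 0) = mu ! i" by (simp add: sum.delta)
  qed
  finally show ?thesis by (simp add: sum_list_sum_nth atLeast0LessThan)
qed

lemma power_sums_monomials:
  assumes "0 \<notin> set mu"
  shows "power_sums x N (mset mu)
    = (\<Sum>a\<in>contents N (sum_list mu). real (pcoef mu a) * (\<Prod>i<N. x i ^ a i))"
proof -
  let ?L = "{vs. length vs = length mu \<and> set vs \<subseteq> {..<N}}"
  have "exponents mu ` ?L \<subseteq> contents N (sum_list mu)"
    using assms sum_exponents[of _ mu N] exponents_bound[of mu _ N] by (auto simp: contents_def)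
  then have "power_sums x N (mset mu) = (\<Sum>a\<in>contents N (sum_list mu).
      \<Sum>vs | vs \<in> ?L \<and> exponents mu vs = a. \<Prod>i<length mu. x (vs ! i) ^ (mu ! i))"
    unfolding power_sums_lists
    by (rule sum.group[OF finite_lists_below finite_contents, symmetric])
  also have "\<dots> = (\<Sum>a\<in>contents N (sum_list mu). real (pcoef mu a) * (\<Prod>i<N. x i ^ a i))"
  proof (rule sum.cong[OF refl])
    fix a assume a: "a \<in> contents N (sum_list mu)"
    have "(\<Sum>vs | vs \<in> ?L \<and> exponents mu vs = a. \<Prod>i<length mu. x (vs ! i) ^ (mu ! i))
        = (\<Sum>vs | vs \<in> ?L \<and> exponents mu vs = a. \<Prod>i<N. x i ^ a i)"
      by (rule sum.cong[OF refl]) (auto simp: prod_exponents)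
    moreover have "{vs. vs \<in> ?L \<and> exponents mu vs = a} = {vs. length vs = length mu \<and> exponents mu vs = a}"
      using a exponents_bound[OF assms, of _ N] by (auto simp: contents_def)
    ultimately show "(\<Sum>vs | vs \<in> ?L \<and> exponents mu vs = a. \<Prod>i<length mu. x (vs ! i) ^ (mu ! i))
        = real (pcoef mu a) * (\<Prod>i<N. x i ^ a i)"
      by (simp add: pcoef_exponents)
  qed
  finally show ?thesis .
qed

text \<open>Induction on the number of variables. As a polynomial in the last variable, with the
  others fixed, the sum vanishes identically, so its coefficient at the exponent \<open>a N\<close>
  is a vanishing combination in fewer variables.\<close>

lemma monomials_independent:
  fixes c :: "(nat \<Rightarrow> nat) \<Rightarrow> real"
  assumes "finite E" "\<And>a i. a \<in> E \<Longrightarrow> i \<ge> N \<Longrightarrow> a i = 0"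
    and "\<And>x :: nat \<Rightarrow> real. (\<Sum>a\<in>E. c a * (\<Prod>i<N. x i ^ a i)) = 0" and "a \<in> E"
  shows "c a = 0"
  using assms
proof (induction N arbitrary: E c a)
  case 0
  have "b = a" if "b \<in> E" for b
    using 0(2)[OF that] 0(2)[OF 0(4)] by (intro ext) simp
  then have "E = {a}" using 0(4) by blast
  with 0(3) show ?case by simp
next
  case (Suc N)
  let ?E = "{b \<in> E. b N = a N}"
  \<comment> \<open>The last exponent is reset to 0 to meet the support condition for
    \<open>N\<close>. All members of \<open>?E\<close> share the value \<open>a N\<close> there, so
    no two monomials are merged and \<open>b(N := a N)\<close> undoes the reset.\<close>
  have inj: "inj_on (\<lambda>b. b(N := 0)) ?E"
    by (rule inj_onI) (metis (mono_tags, lifting) fun_upd_triv fun_upd_upd mem_Collect_eq)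
  have "(\<Sum>b\<in>?E. c b * (\<Prod>i<N. x i ^ b i)) = 0" for x :: "nat \<Rightarrow> real"
  proof -
    let ?D = "Max ((\<lambda>b. b N) ` E)"
    have D: "b N \<le> ?D" if "b \<in> E" for b using that Suc.prems(1) by auto
    have "(\<Sum>e\<le>?D. (\<Sum>b | b \<in> E \<and> b N = e. c b * (\<Prod>i<N. x i ^ b i)) * t ^ e) = 0" for t
    proof -
      have "(\<Sum>e\<le>?D. (\<Sum>b | b \<in> E \<and> b N = e. c b * (\<Prod>i<N. x i ^ b i)) * t ^ e)
          = (\<Sum>e\<le>?D. \<Sum>b | b \<in> E \<and> b N = e. c b * (\<Prod>i<Suc N. (x(N := t)) i ^ b i))"
        unfolding sum_distrib_right by (intro sum.cong refl) (auto simp: mult_ac)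
      also have "\<dots> = (\<Sum>b\<in>E. c b * (\<Prod>i<Suc N. (x(N := t)) i ^ b i))"
        by (rule sum.group) (use Suc.prems(1) D in auto)
      also have "\<dots> = 0" by (rule Suc.prems(3))
      finally show ?thesis .
    qed
    from zero_polynom_imp_zero_coeffs[of "\<lambda>e. \<Sum>b | b \<in> E \<and> b N = e. c b * (\<Prod>i<N. x i ^ b i)",
        OF this D[OF Suc.prems(4)]]
    show ?thesis .
  qed
  then have "(\<Sum>b\<in>(\<lambda>b. b(N := 0)) ` ?E. c (b(N := a N)) * (\<Prod>i<N. x i ^ b i)) = 0" for x :: "nat \<Rightarrow> real"
  proof -
    have "(\<Sum>b\<in>(\<lambda>b. b(N := 0)) ` ?E. c (b(N := a N)) * (\<Prod>i<N. x i ^ b i))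
        = (\<Sum>b\<in>?E. c b * (\<Prod>i<N. x i ^ b i))"
      unfolding sum.reindex[OF inj]
    proof (rule sum.cong[OF refl])
      fix b assume "b \<in> ?E"
      then have "b(N := a N) = b" by auto
      then show "((\<lambda>b. c (b(N := a N)) * (\<Prod>i<N. x i ^ b i)) \<circ> (\<lambda>b. b(N := 0))) b
          = c b * (\<Prod>i<N. x i ^ b i)" by simp
    qed
    then show ?thesis using \<open>\<And>x. (\<Sum>b\<in>?E. c b * (\<Prod>i<N. x i ^ b i)) = 0\<close> by simp
  qed
  moreover have "b i = 0" if "b \<in> (\<lambda>b. b(N := 0)) ` ?E" "i \<ge> N" for b i
    using that Suc.prems(2)[of _ i] by auto
  moreover have "finite ((\<lambda>b. b(N := 0)) ` ?E)" "a(N := 0) \<in> (\<lambda>b. b(N := 0)) ` ?E"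
    by (intro finite_imageI imageI; simp add: Suc.prems(1,4))+
  ultimately have "c ((a(N := 0))(N := a N)) = 0"
    using Suc.IH[where c = "\<lambda>b. c (b(N := a N))" and E = "(\<lambda>b. b(N := 0)) ` ?E" and a = "a(N := 0)"]
    by blast
  then show ?case by simp
qed

section \<open>From evaluations to coefficients, and uniqueness of the expansion\<close>

definition partition_list :: "nat multiset \<Rightarrow> nat list" where
  "partition_list mu = rev (sorted_list_of_multiset mu)"

lemma mset_partition_list [simp]: "mset (partition_list mu) = mu"
  by (simp add: partition_list_def)

lemma set_partition_list [simp]: "set (partition_list mu) = set_mset mu"
  by (metis mset_partition_list set_mset_mset)

lemma sum_partition_list [simp]: "sum_list (partition_list mu) = sum_mset mu"
  by (metis mset_partition_list sum_mset_sum_list)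

lemma zero_notin_odd_partition: "mu \<in> odd_partitions n \<Longrightarrow> 0 \<notin># mu"
  unfolding odd_partitions_def using even_zero by blast

lemma is_partition_partition_list:
  assumes "mu \<in> odd_partitions n" shows "is_partition (partition_list mu)"
  using zero_notin_odd_partition[OF assms]
  by (simp add: is_partition_def) (simp add: partition_list_def)

text \<open>\<open>p_positive\<close> also tests vectors of infinite support or of wrong degree,
  which the evaluations do not reach. There both sides of the expansion are 0.\<close>

lemma rcoef_outside_contents:
  assumes "1 \<le> k" "k \<le> n" "\<And>N. a \<notin> contents N n"
  shows "rcoef (triangle n k) a = 0"
proof -
  have False if w: "w \<in> hook_words n k" "word_content w = a" for w
  proof -
    obtain N where "\<forall>m\<in>set w. m < N"
      using finite_nat_set_iff_bounded[of "set w"] by auto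
    then have N: "set w \<subseteq> {..<2 * N}" by force
    have "word_content w i = 0" if "i \<ge> N" for i
      using N that by (auto simp: word_content_def filter_empty_conv subset_iff)
    moreover have "length w = n" using w(1) by (simp add: hook_words_def)
    ultimately have "a \<in> contents N n"
      using sum_word_content[OF N] w(2) by (auto simp: contents_def)
    then show False using assms(3) by blast
  qed
  then have "{w \<in> hook_words n k. word_content w = a} = {}" by blast
  then show ?thesis unfolding rcoef_triangle[OF assms(1,2)] by (metis card.empty)
qed

lemma pcoef_outside_contents:
  assumes "0 \<notin> set mu" "\<And>N. a \<notin> contents N (sum_list mu)"
  shows "pcoef mu a = 0"
proof -
  have False if vs: "length vs = length mu" "exponents mu vs = a" for vs
  proof -
    obtain N where N: "set vs \<subseteq> {..<N}"
      using finite_nat_set_iff_bounded[of "set vs"] by auto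
    then have "a \<in> contents N (sum_list mu)"
      using exponents_bound[OF assms(1) vs(1), of N] sum_exponents[OF vs(1) N] vs(2)
      by (auto simp: contents_def)
    then show False using assms(2) by blast
  qed
  then have "{vs. length vs = length mu \<and> exponents mu vs = a} = {}" by blast
  then show ?thesis unfolding pcoef_exponents by (metis card.empty)
qed

definition hook_coeff :: "nat \<Rightarrow> nat multiset \<Rightarrow> real" where
  "hook_coeff k mu = odd_weight mu * alternating_sums mu $ (k - 1)"

text \<open>If \<open>a\<close> uses only the first N variables, both sides, summed against all
  monomials of degree n in these variables, give \<open>hook_sum\<close> at every real point;
  \<open>monomials_independent\<close> then compares coefficients.\<close>

lemma rfun_triangle_expansion:
  assumes "1 \<le> k" "k \<le> n"
  shows "rfun (triangle n k) a
    = (\<Sum>mu\<in>odd_partitions n. hook_coeff k mu * real (pcoef (partition_list mu) a))"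
proof (cases "\<exists>N. a \<in> contents N n")
  case False
  have "pcoef (partition_list mu) a = 0" if "mu \<in> odd_partitions n" for mu
    using that False zero_notin_odd_partition[OF that]
    by (intro pcoef_outside_contents) (simp_all add: odd_partitions_def)
  then show ?thesis
    using rcoef_outside_contents[OF assms] False by (simp add: rfun_def)
next
  case True
  then obtain N where N: "a \<in> contents N n" ..
  let ?S = "\<lambda>a. \<Sum>mu\<in>odd_partitions n. hook_coeff k mu * real (pcoef (partition_list mu) a)"
  have "rfun (triangle n k) a - ?S a = 0"
  proof (rule monomials_independent[OF finite_contents _ _ N])
    show "b i = 0" if "b \<in> contents N n" "i \<ge> N" for b i
      using that by (simp add: contents_def)
    fix x :: "nat \<Rightarrow> real"
    have "(\<Sum>b\<in>contents N n. ?S b * (\<Prod>i<N. x i ^ b i))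
        = (\<Sum>mu\<in>odd_partitions n. \<Sum>b\<in>contents N n.
            hook_coeff k mu * real (pcoef (partition_list mu) b) * (\<Prod>i<N. x i ^ b i))"
      unfolding sum_distrib_right by (rule sum.swap)
    also have "\<dots> = (\<Sum>mu\<in>odd_partitions n. hook_coeff k mu * power_sums x N mu)"
    proof (rule sum.cong[OF refl])
      fix mu assume mu: "mu \<in> odd_partitions n"
      then have "0 \<notin> set (partition_list mu)" by (simp add: zero_notin_odd_partition)
      from power_sums_monomials[OF this, of x N] mu
      show "(\<Sum>b\<in>contents N n. hook_coeff k mu * real (pcoef (partition_list mu) b) * (\<Prod>i<N. x i ^ b i))
          = hook_coeff k mu * power_sums x N mu"
        by (simp add: odd_partitions_def sum_distrib_left mult.assoc)
    qed
    also have "\<dots> = hook_sum x N n k"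
      unfolding hook_sum_expansion[OF assms] hook_coeff_def ..
    also have "\<dots> = (\<Sum>b\<in>contents N n. rfun (triangle n k) b * (\<Prod>i<N. x i ^ b i))"
      unfolding hook_sum_monomials rfun_def rcoef_triangle[OF assms] ..
    finally show "(\<Sum>b\<in>contents N n. (rfun (triangle n k) b - ?S b) * (\<Prod>i<N. x i ^ b i)) = 0"
      by (simp add: left_diff_distrib sum_subtractf)
  qed
  then show ?thesis by simp
qed

lemma pcoef_self_pos:
  assumes "is_partition mu"
  defines "a \<equiv> \<lambda>j. if j < length mu then mu ! j else 0"
  shows "pcoef mu a > 0"
proof -
  let ?S = "{vs. length vs = length mu \<and> exponents mu vs = a}"
  have z: "0 \<notin> set mu" using assms(1) by (simp add: is_partition_def)
  have "exponents mu [0..<length mu] = a"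
    by (rule ext) (simp add: exponents_def a_def cong: if_cong)
  then have "[0..<length mu] \<in> ?S" by simp
  \<comment> \<open>\<open>card\<close> is 0 on infinite sets, so a member of \<open>?S\<close>
    alone would not give positivity.\<close>
  moreover have "finite ?S"
  proof (rule finite_subset[OF _ finite_lists_below[of "length mu" "length mu"]])
    show "?S \<subseteq> {vs. length vs = length mu \<and> set vs \<subseteq> {..<length mu}}"
    proof
      fix vs assume "vs \<in> ?S"
      moreover then have "set vs \<subseteq> {..<length mu}"
        using exponents_bound[OF z, of vs "length mu"] by (simp add: a_def)
      ultimately show "vs \<in> {vs. length vs = length mu \<and> set vs \<subseteq> {..<length mu}}" by simp
    qed
  qed
  ultimately show ?thesis unfolding pcoef_exponents by (metis card_gt_0_iff empty_iff)
qed

text \<open>A monomial $x^\mu$ occurs in $p_\lambda$ only if $\mu$ is obtained by adding up parts of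
  $\lambda$.\<close>

lemma pcoef_triangular:
  assumes "is_partition mu" "is_partition la" "length la \<le> length mu"
  defines "a \<equiv> \<lambda>j. if j < length mu then mu ! j else 0"
  assumes "pcoef la a \<noteq> 0"
  shows "la = mu"
proof -
  obtain vs where vs: "length vs = length la" "exponents la vs = a"
    using assms(5) unfolding pcoef_exponents
    by (metis (mono_tags, lifting) card.empty empty_Collect_eq)
  have z: "0 \<notin> set la" "0 \<notin> set mu" using assms(1,2) by (auto simp: is_partition_def)
  have "a j \<noteq> 0 \<longleftrightarrow> j < length mu" for j
    using z(2) in_set_conv_nth[of 0 mu] by (auto simp: a_def)
  moreover have "a j \<noteq> 0 \<longleftrightarrow> j \<in> (!) vs ` {..<length la}" for j
    unfolding vs(2)[symmetric] exponents_eq_0_iff[OF z(1)] by auto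
  ultimately have img: "(!) vs ` {..<length la} = {..<length mu}" by auto
  \<comment> \<open>Every variable of the monomial must receive a part, so \<open>la\<close> is at
    least as long as \<open>mu\<close>. With the assumed bound the assignment is a bijection, and no
    two parts of \<open>la\<close> are added.\<close>
  have "card {..<length mu} \<le> card {..<length la}"
    using surj_card_le[of "{..<length la}" "{..<length mu}" "(!) vs"] img by simp
  then have len: "length la = length mu" using assms(3) by simp
  then have inj: "inj_on ((!) vs) {..<length la}"
    using img by (intro eq_card_imp_inj_on) auto
  have "mu ! (vs ! i) = la ! i" if "i < length la" for i
  proof -
    have "vs ! i < length mu" using img that by blast
    then have "mu ! (vs ! i) = exponents la vs (vs ! i)" by (simp add: vs(2) a_def)
    also have "\<dots> = (\<Sum>i'<length la. if i' = i then la ! i' else 0)"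
      unfolding exponents_def by (rule sum.cong[OF refl]) (use inj that in \<open>auto simp: inj_on_def\<close>)
    finally show ?thesis using that by simp
  qed
  then have "image_mset ((!) la) (mset_set {..<length la})
      = image_mset ((!) mu) (image_mset ((!) vs) (mset_set {..<length la}))"
    unfolding image_mset.compositionality by (intro image_mset_cong) auto
  also have "image_mset ((!) vs) (mset_set {..<length la}) = mset_set {..<length mu}"
    using image_mset_mset_set[OF inj] img by simp
  finally have "mset la = mset mu"
    by (metis mset_map map_nth mset_upt atLeast0LessThan)
  then have "mset (rev la) = mset (rev mu)" by simp
  moreover have "sorted (rev la)" "sorted (rev mu)"
    using assms(1,2) by (auto simp: is_partition_def)
  ultimately have "rev la = rev mu"
    by (metis properties_for_sort)
  then show ?thesis by simp
qed

text \<open>At the monomial of a longest \<open>nu\<close> with nonzero coefficient,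
  \<open>pcoef_triangular\<close> removes every term but that of \<open>nu\<close>.\<close>

lemma pcoef_independent:
  fixes e :: "nat list \<Rightarrow> real"
  assumes fin: "finite S" and part: "\<And>mu. mu \<in> S \<Longrightarrow> is_partition mu"
    and zero: "\<And>a. (\<Sum>mu\<in>S. e mu * real (pcoef mu a)) = 0"
    and "mu \<in> S"
  shows "e mu = 0"
proof (rule ccontr)
  assume "e mu \<noteq> 0"
  let ?X = "{mu \<in> S. e mu \<noteq> 0}"
  have "finite ?X" "?X \<noteq> {}" using fin assms(4) \<open>e mu \<noteq> 0\<close> by auto
  then have "Max (length ` ?X) \<in> length ` ?X" by (intro Max_in) auto
  then obtain nu where "Max (length ` ?X) = length nu" and nu: "nu \<in> ?X" by (rule imageE)
  then have max: "length la \<le> length nu" if "la \<in> ?X" for la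
    using Max_ge[of "length ` ?X" "length la"] that \<open>finite ?X\<close> by simp
  let ?a = "\<lambda>j. if j < length nu then nu ! j else 0"
  have "e la * real (pcoef la ?a) = 0" if "la \<in> S - {nu}" for la
    using that pcoef_triangular[of nu la] max[of la] nu part by auto
  then have "(\<Sum>mu\<in>S - {nu}. e mu * real (pcoef mu ?a)) = 0"
    by (intro sum.neutral ballI)
  then have "(\<Sum>mu\<in>S. e mu * real (pcoef mu ?a)) = e nu * real (pcoef nu ?a)"
    using fin nu by (subst sum.remove[of _ nu]) auto
  then have "e nu * real (pcoef nu ?a) = 0" using zero by simp
  then show False using nu part pcoef_self_pos[of nu] by simp
qed

text \<open>The expansion into odd partitions is the only one, and \<open>odd_weight\<close> is
  positive, so the sign of each coefficient is that of A_mu at u^(k-1).\<close>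

lemma p_positive_triangle_iff:
  assumes "1 \<le> k" "k \<le> n"
  shows "p_positive (rfun (triangle n k))
    \<longleftrightarrow> (\<forall>mu\<in>odd_partitions n. alternating_sums mu $ (k - 1) \<ge> 0)"
proof
  let ?D = "partition_list ` odd_partitions n"
  let ?d = "\<lambda>la. hook_coeff k (mset la)"
  have inj: "inj_on partition_list (odd_partitions n)"
    by (rule inj_onI) (metis mset_partition_list)
  have expansion: "rfun (triangle n k) a = (\<Sum>la\<in>?D. ?d la * real (pcoef la a))" for a
    unfolding rfun_triangle_expansion[OF assms] by (simp add: sum.reindex[OF inj])
  have finD: "finite ?D" by (simp add: finite_odd_partitions)
  have sign: "hook_coeff k mu \<ge> 0 \<longleftrightarrow> alternating_sums mu $ (k - 1) \<ge> 0" if "mu \<in> odd_partitions n" for mu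
    using odd_weight_pos[OF that] by (simp add: hook_coeff_def zero_le_mult_iff)
  {
    assume "\<forall>mu\<in>odd_partitions n. alternating_sums mu $ (k - 1) \<ge> 0"
    then have "\<forall>la\<in>?D. is_partition la \<and> ?d la \<ge> 0"
      using is_partition_partition_list sign by auto
    with finD have "finite ?D \<and> (\<forall>la\<in>?D. is_partition la \<and> ?d la \<ge> 0) \<and>
        (\<forall>a. rfun (triangle n k) a = (\<Sum>la\<in>?D. ?d la * real (pcoef la a)))"
      using expansion by (intro conjI allI)
    then show "p_positive (rfun (triangle n k))"
      unfolding p_positive_def by (intro exI)
  next
    assume "p_positive (rfun (triangle n k))"
    then obtain C c where C: "finite C" "\<forall>la\<in>C. is_partition la \<and> c la \<ge> (0::real)"
      and c: "\<And>a. rfun (triangle n k) a = (\<Sum>la\<in>C. c la * real (pcoef la a))"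
      unfolding p_positive_def by blast
    \<comment> \<open>The given combination may involve other partitions, even of other sizes; both
      coefficient functions are extended by 0 to a common index set.\<close>
    let ?c = "\<lambda>la. if la \<in> C then c la else 0" and ?d' = "\<lambda>la. if la \<in> ?D then ?d la else 0"
    show "\<forall>mu\<in>odd_partitions n. alternating_sums mu $ (k - 1) \<ge> 0"
    proof
      fix mu assume mu: "mu \<in> odd_partitions n"
      have "?c (partition_list mu) - ?d' (partition_list mu) = 0"
      proof (rule pcoef_independent[of "C \<union> ?D"])
        show "finite (C \<union> ?D)" using C finD by simp
        show "partition_list mu \<in> C \<union> ?D" using mu by simp
        show "is_partition la" if "la \<in> C \<union> ?D" for la
          using that C is_partition_partition_list by auto
        fix a
        have "(\<Sum>la\<in>C \<union> ?D. ?c la * real (pcoef la a)) = (\<Sum>la\<in>C. c la * real (pcoef la a))"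
          by (rule sum.mono_neutral_cong_right) (use C finD in auto)
        moreover have "(\<Sum>la\<in>C \<union> ?D. ?d' la * real (pcoef la a)) = (\<Sum>la\<in>?D. ?d la * real (pcoef la a))"
          by (rule sum.mono_neutral_cong_right) (use C finD in auto)
        ultimately show "(\<Sum>la\<in>C \<union> ?D. (?c la - ?d' la) * real (pcoef la a)) = 0"
          using c[of a] expansion[of a] by (simp add: left_diff_distrib sum_subtractf)
      qed
      then have "hook_coeff k mu = ?c (partition_list mu)" using mu by simp
      also have "\<dots> \<ge> 0" using C by simp
      finally show "alternating_sums mu $ (k - 1) \<ge> 0" using sign[OF mu] by simp
    qed
  }
qed

section \<open>Signs of the coefficients\<close>

lemma X_power_factor_nth:
  "((1 + fps_X ^ m) * f) $ j = f $ j + (if j < m then 0 else f $ (j - m))" for f :: "real fps"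
  by (simp add: distrib_right fps_X_power_mult_nth)

lemma subset_sums_empty [simp]: "subset_sums {#} = 1"
  by (simp add: subset_sums_def)

lemma subset_sums_add_mset_nth:
  "subset_sums (add_mset m mu) $ j = subset_sums mu $ j + (if j < m then 0 else subset_sums mu $ (j - m))"
  by (simp add: subset_sums_def X_power_factor_nth del: fps_mult_nth)

lemma alternating_sums_add_mset_nth:
  "alternating_sums (add_mset m mu) $ j
     = alternating_sums mu $ j + (if j < m then 0 else alternating_sums mu $ (j - m))"
proof -
  have "alternating_sums (add_mset m mu) = (1 + fps_X ^ m) * alternating_sums mu"
    by (simp add: alternating_sums_def subset_sums_def mult_ac)
  then show ?thesis by (simp only: X_power_factor_nth)
qed

lemma alternating_sums_empty_nth: "alternating_sums {#} $ j = (- 1) ^ j"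
  by (simp add: alternating_sums_def fps_inverse_fps_X_plus1)

lemma alternating_sums_nth_0: "alternating_sums mu $ 0 = subset_sums mu $ 0"
  by (simp flip: one_plus_X_alternating_sums)

lemma alternating_sums_nth_Suc:
  "alternating_sums mu $ Suc j + alternating_sums mu $ j = subset_sums mu $ Suc j"
  by (simp add: distrib_right flip: one_plus_X_alternating_sums)

lemma subset_sums_nonneg: "subset_sums mu $ j \<ge> 0"
  by (induction mu arbitrary: j) (auto simp: subset_sums_add_mset_nth)

lemma subset_sums_nth_0: "0 \<notin># mu \<Longrightarrow> subset_sums mu $ 0 = 1"
  by (induction mu) (auto simp: subset_sums_add_mset_nth)

lemma subset_sums_beyond: "j > sum_mset mu \<Longrightarrow> subset_sums mu $ j = 0"
  by (induction mu arbitrary: j) (auto simp: subset_sums_add_mset_nth)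

text \<open>Taking the complementary set of parts, carried out one part at a time.\<close>

lemma subset_sums_symmetric:
  "j \<le> sum_mset mu \<Longrightarrow> subset_sums mu $ (sum_mset mu - j) = subset_sums mu $ j"
proof (induction mu arbitrary: j)
  case (add m mu)
  let ?s = "sum_mset mu"
  have low: "subset_sums mu $ j = (if m + ?s - j < m then 0 else subset_sums mu $ (?s - j))"
    using add.IH[of j] subset_sums_beyond[of mu j] add.prems by auto
  have high: "subset_sums mu $ (m + ?s - j) = (if j < m then 0 else subset_sums mu $ (j - m))"
  proof (cases "j < m")
    case False
    then have "?s - (j - m) = m + ?s - j" "j - m \<le> ?s" using add.prems by auto
    then show ?thesis using add.IH[of "j - m"] False by simp
  qed (simp add: subset_sums_beyond)
  have "m + ?s - j - m = ?s - j" by simp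
  then show ?case
    using low high by (simp add: subset_sums_add_mset_nth)
qed simp

lemma alternating_sums_beyond_shift:
  assumes "j \<ge> sum_mset mu"
  shows "alternating_sums mu $ (j + i) = (- 1) ^ i * alternating_sums mu $ j"
proof (induction i)
  case (Suc i)
  have "subset_sums mu $ Suc (j + i) = 0"
    using assms by (intro subset_sums_beyond) simp
  then show ?case using Suc alternating_sums_nth_Suc[of mu "j + i"] by simp
qed simp

text \<open>Split off one odd part m. Beyond the sum of the remaining parts the coefficients merely
  alternate in sign, so those at j and j - m cancel.\<close>

lemma alternating_sums_beyond:
  assumes "mu \<in> odd_partitions n" "1 \<le> n" "j \<ge> n"
  shows "alternating_sums mu $ j = 0"
proof -
  have "sum_mset mu = n" using assms(1) by (simp add: odd_partitions_def)
  then have "mu \<noteq> {#}" using assms(2) by auto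
  then obtain m nu where mu: "mu = add_mset m nu" by (meson multiset_cases)
  have m: "odd m" and n: "n = m + sum_mset nu"
    using assms(1) by (simp_all add: mu odd_partitions_def)
  have "alternating_sums nu $ (j - m + m) = - alternating_sums nu $ (j - m)"
    using alternating_sums_beyond_shift[of nu "j - m" m] assms(3) m n by simp
  then show ?thesis
    using assms(3) n by (simp add: mu alternating_sums_add_mset_nth)
qed

text \<open>The relation of neighbouring coefficients is followed inwards from both ends, using the
  symmetry of the product. It starts because the coefficient at u^n vanishes.\<close>

lemma alternating_sums_symmetric:
  assumes mu: "mu \<in> odd_partitions n" and "j < n"
  shows "alternating_sums mu $ (n - 1 - j) = alternating_sums mu $ j"
  using assms(2)
proof (induction j)
  case 0
  have s: "sum_mset mu = n" using mu by (simp add: odd_partitions_def)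
  obtain i where i: "n = Suc i" using 0 by (cases n) auto
  have "alternating_sums mu $ n = 0"
    using alternating_sums_beyond[OF mu] 0 by simp
  moreover have "subset_sums mu $ n = subset_sums mu $ 0"
    using subset_sums_symmetric[of 0 mu] s by simp
  ultimately show ?case
    using alternating_sums_nth_Suc[of mu i] i by (simp add: alternating_sums_nth_0)
next
  case (Suc j)
  have s: "sum_mset mu = n" using mu by (simp add: odd_partitions_def)
  have "subset_sums mu $ (n - Suc j) = subset_sums mu $ Suc j"
    using subset_sums_symmetric[of "Suc j" mu] s Suc.prems by simp
  moreover have "Suc (n - 1 - Suc j) = n - Suc j" "n - 1 - j = n - Suc j"
    using Suc.prems by simp_all
  moreover have "alternating_sums mu $ (n - 1 - j) = alternating_sums mu $ j"
    using Suc by simp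
  ultimately show ?case
    using alternating_sums_nth_Suc[of mu j] alternating_sums_nth_Suc[of mu "n - 1 - Suc j"] by simp
qed

text \<open>Odd parts other than 1 are at least 3, so a sum of 1 or 2 can only use parts equal to
  1.\<close>

lemma subset_sums_nth_1_2:
  assumes "\<forall>m\<in>#mu. odd m"
  shows "subset_sums mu $ 1 = real (count mu 1)"
    and "2 * subset_sums mu $ 2 = real (count mu 1) * (real (count mu 1) - 1)"
proof -
  have "subset_sums mu $ 1 = real (count mu 1) \<and>
      2 * subset_sums mu $ 2 = real (count mu 1) * (real (count mu 1) - 1)"
    using assms
  proof (induction mu)
    case (add m mu)
    have "0 \<notin># mu" using add.prems even_zero by auto
    then have 0: "subset_sums mu $ 0 = 1" by (rule subset_sums_nth_0)
    have IH: "subset_sums mu $ 1 = real (count mu 1)"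
      "2 * subset_sums mu $ 2 = real (count mu 1) * (real (count mu 1) - 1)"
      using add by simp_all
    show ?case
    proof (cases "m = 1")
      case True
      then show ?thesis
        using 0 IH by (simp add: subset_sums_add_mset_nth algebra_simps)
    next
      case False
      have "odd m" using add.prems by simp
      with False have "m > 2" by (cases "m = 2"; cases "m = 0") auto
      then show ?thesis using IH False by (simp add: subset_sums_add_mset_nth)
    qed
  qed (simp add: numeral_2_eq_2)
  then show "subset_sums mu $ 1 = real (count mu 1)"
    "2 * subset_sums mu $ 2 = real (count mu 1) * (real (count mu 1) - 1)" by simp_all
qed

lemma alternating_sums_nth_2_nonneg:
  assumes "mu \<in> odd_partitions n"
  shows "alternating_sums mu $ 2 \<ge> 0"
proof -
  let ?c = "real (count mu 1)"
  have odd: "\<forall>m\<in>#mu. odd m" using assms by (simp add: odd_partitions_def)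
  have "alternating_sums mu $ 0 = 1"
    using subset_sums_nth_0[OF zero_notin_odd_partition[OF assms]] by (simp add: alternating_sums_nth_0)
  then have "alternating_sums mu $ 2 = subset_sums mu $ 2 - subset_sums mu $ 1 + 1"
    using alternating_sums_nth_Suc[of mu 0] alternating_sums_nth_Suc[of mu 1]
    by (simp add: numeral_2_eq_2)
  then have "2 * alternating_sums mu $ 2 = (?c - 1) * (?c - 2)"
    using subset_sums_nth_1_2[OF odd] by (simp add: algebra_simps)
  \<comment> \<open>The product is negative only strictly between 1 and 2, where there is no
    integer.\<close>
  moreover have "(?c - 1) * (?c - 2) \<ge> 0"
  proof (cases "count mu 1 < 2")
    case True
    then have "count mu 1 = 0 \<or> count mu 1 = 1" by auto
    then show ?thesis by auto
  next
    case False
    then have "?c \<ge> 2" by linarith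
    then show ?thesis by (intro mult_nonneg_nonneg) linarith+
  qed
  ultimately show ?thesis by simp
qed

text \<open>The degree n - 1 is odd, so symmetry makes the coefficients at n/2 - 1 and n/2 equal;
  their sum is a coefficient of the product.\<close>

lemma alternating_sums_middle_nonneg:
  assumes mu: "mu \<in> odd_partitions n" and "2 \<le> n" "even n"
  shows "alternating_sums mu $ (n div 2 - 1) \<ge> 0"
proof -
  obtain i where n: "n = 2 * Suc i" using assms(2,3) by (metis evenE not0_implies_Suc mult_0_right not_numeral_le_zero)
  have "alternating_sums mu $ Suc i = alternating_sums mu $ i"
    using alternating_sums_symmetric[OF mu, of i] n by simp
  then have "2 * alternating_sums mu $ i = subset_sums mu $ Suc i"
    using alternating_sums_nth_Suc[of mu i] by simp
  then have "alternating_sums mu $ i \<ge> 0" using subset_sums_nonneg[of mu "Suc i"] by simp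
  then show ?thesis by (simp add: n)
qed

lemmas alternating_sums_nth =
  alternating_sums_add_mset_nth alternating_sums_empty_nth minus_one_power_iff

section \<open>Partitions with a negative coefficient\<close>

definition has_negative :: "nat \<Rightarrow> nat \<Rightarrow> bool" where
  "has_negative n k \<longleftrightarrow> (\<exists>mu\<in>odd_partitions n. alternating_sums mu $ (k - 1) < 0)"

lemma has_negativeI:
  "(\<forall>m\<in>#mu. odd m) \<Longrightarrow> sum_mset mu = n \<Longrightarrow> alternating_sums mu $ (k - 1) < 0 \<Longrightarrow> has_negative n k"
  unfolding has_negative_def odd_partitions_def by blast

lemma has_negative_symmetric:
  assumes "1 \<le> k" "k \<le> n" "has_negative n (n + 1 - k)"
  shows "has_negative n k"
proof -
  obtain mu where mu: "mu \<in> odd_partitions n" "alternating_sums mu $ (n + 1 - k - 1) < 0"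
    using assms(3) by (auto simp: has_negative_def)
  have "n - 1 - (k - 1) = n + 1 - k - 1" using assms by simp
  then have "alternating_sums mu $ (k - 1) < 0"
    using alternating_sums_symmetric[OF mu(1), of "k - 1"] mu(2) assms by simp
  with mu(1) show ?thesis by (auto simp: has_negative_def)
qed

text \<open>The only part n exceeds k - 1, which leaves (-1)^(k-1) = -1.\<close>

lemma has_negative_odd_even:
  assumes "odd n" "even k" "1 \<le> k" "k \<le> n"
  shows "has_negative n k"
proof (rule has_negativeI[of "{#n#}"])
  show "alternating_sums {#n#} $ (k - 1) < 0"
    using assms by (simp add: alternating_sums_nth)
qed (use assms in auto)

text \<open>The empty choice gives +1, the parts k - 2 and 3 give -1 each, and their sum is too
  large to count. The part n - k - 1 can add a further -1, and only then a single +1 together with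
  3.\<close>

lemma has_negative_odd_odd:
  assumes "odd n" "odd k" "5 \<le> k" "k + 4 \<le> n"
  shows "has_negative n k"
proof -
  obtain i where "k = 2 * i + 5"
    using assms(2,3) by (metis add.commute even_add even_numeral le_Suc_ex oddE odd_numeral evenE)
  moreover obtain l where "n = k + 4 + 2 * l"
    using assms by (metis even_add even_numeral evenE le_Suc_ex)
  ultimately have k: "k = 2 * i + 5" and n: "n = 2 * i + 2 * l + 9" by auto
  show ?thesis
  proof (rule has_negativeI[of "{#2 * i + 3, 3, 2 * l + 3#}"])
    show "alternating_sums {#2 * i + 3, 3, 2 * l + 3#} $ (k - 1) < 0"
      by (simp add: k alternating_sums_nth)
  qed (auto simp: n)
qed

text \<open>Both parts exceed k - 1, the second because 2k + 2 <= n, so only (-1)^(k-1) = -1 is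
  left.\<close>

lemma has_negative_even_even:
  assumes "even n" "even k" "1 \<le> k" "2 * k + 2 \<le> n"
  shows "has_negative n k"
proof (rule has_negativeI[of "{#k + 1, n - k - 1#}"])
  have "k - 1 < k + 1" "k - 1 < n - k - 1" using assms by linarith+
  then show "alternating_sums {#k + 1, n - k - 1#} $ (k - 1) < 0"
    using assms by (simp add: alternating_sums_nth)
qed (use assms in auto)

text \<open>The empty choice gives +1, the parts k - 2, 3, 3 give -1 each, and the pair of threes at
  most +1. Since n - k - 4 >= k - 2, the last part can count only alone, again with -1.\<close>

lemma has_negative_even_odd:
  assumes "even n" "odd k" "5 \<le> k" "2 * k + 2 \<le> n"
  shows "has_negative n k"
proof -
  obtain i where "k = 2 * i + 5"
    using assms(2,3) by (metis add.commute even_add even_numeral le_Suc_ex oddE odd_numeral evenE)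
  moreover obtain l where "n = 2 * k + 2 + 2 * l"
    using assms by (metis even_add even_numeral even_mult_iff evenE le_Suc_ex)
  ultimately have k: "k = 2 * i + 5" and n: "n = 4 * i + 2 * l + 12" by auto
  show ?thesis
  proof (rule has_negativeI[of "{#2 * i + 3, 3, 3, 2 * i + 2 * l + 3#}"])
    show "alternating_sums {#2 * i + 3, 3, 3, 2 * i + 2 * l + 3#} $ (k - 1) < 0"
      by (simp add: k alternating_sums_nth) arith
  qed (auto simp: n)
qed

lemma has_negative_even:
  assumes "even n" "1 \<le> k" "2 * k + 2 \<le> n" "k \<noteq> 1" "k \<noteq> 3"
  shows "has_negative n k"
proof (cases "even k")
  case True
  then show ?thesis using assms by (intro has_negative_even_even) auto
next
  case False
  then have "k \<ge> 5" using assms by presburger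
  then show ?thesis using assms False by (intro has_negative_even_odd) auto
qed

lemma p_positive_triangle_iff_not_has_negative:
  "1 \<le> k \<Longrightarrow> k \<le> n \<Longrightarrow> p_positive (rfun (triangle n k)) \<longleftrightarrow> \<not> has_negative n k"
  by (auto simp: p_positive_triangle_iff has_negative_def not_less)

lemma p_positive_triangle_symmetric:
  assumes "1 \<le> k" "k \<le> n"
  shows "p_positive (rfun (triangle n (n + 1 - k))) \<longleftrightarrow> p_positive (rfun (triangle n k))"
  using has_negative_symmetric[of k n] has_negative_symmetric[of "n + 1 - k" n] assms
  by (auto simp: p_positive_triangle_iff_not_has_negative)

lemma p_positive_triangle_1:
  assumes "1 \<le> n" shows "p_positive (rfun (triangle n 1))"
  using assms subset_sums_nth_0[OF zero_notin_odd_partition]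
  by (auto simp: p_positive_triangle_iff alternating_sums_nth_0)

lemma p_positive_triangle_3:
  assumes "3 \<le> n" shows "p_positive (rfun (triangle n 3))"
  using assms alternating_sums_nth_2_nonneg by (auto simp: p_positive_triangle_iff)

lemma p_positive_triangle_half:
  assumes "2 \<le> n" "even n" shows "p_positive (rfun (triangle n (n div 2)))"
  using assms alternating_sums_middle_nonneg by (subst p_positive_triangle_iff) auto

theorem mainTheorem12:
  fixes n k :: nat
  assumes "1 \<le> k" and "k \<le> n"
  shows "(n \<le> 2 \<longrightarrow> p_positive (rfun (triangle n k)))
       \<and> (3 \<le> n \<and> odd n \<longrightarrow>
            (p_positive (rfun (triangle n k)) \<longleftrightarrow> k \<in> {1, 3, n - 2, n}))
       \<and> (4 \<le> n \<and> even n \<longrightarrow>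
            (p_positive (rfun (triangle n k)) \<longleftrightarrow>
               k \<in> {1, 3, n div 2, n div 2 + 1, n - 2, n}))"
proof -
  let ?pos = "p_positive (rfun (triangle n k))"
  have mirror: "?pos" if "p_positive (rfun (triangle n (n + 1 - k)))"
    using that p_positive_triangle_symmetric[OF assms] by simp
  have ends: "?pos" if "k = 1 \<or> k = n"
    using that p_positive_triangle_1[of n] assms mirror by (cases "k = n") simp_all
  have third: "?pos" if "3 \<le> n" "k = 3 \<or> k = n - 2"
  proof -
    have "n + 1 - k = 3" if "k = n - 2" using that \<open>3 \<le> n\<close> by simp
    then show ?thesis using that p_positive_triangle_3[of n] mirror by auto
  qed
  have half: "?pos" if "4 \<le> n" "even n" "k = n div 2 \<or> k = n div 2 + 1"
  proof -
    have "n + 1 - k = n div 2" if "k = n div 2 + 1" using that \<open>even n\<close> by (auto elim: evenE)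
    then show ?thesis using that p_positive_triangle_half[of n] mirror by auto
  qed
  have "k \<in> {1, 3, n - 2, n}" if "odd n" "?pos"
  proof (rule ccontr)
    assume k: "k \<notin> {1, 3, n - 2, n}"
    have "has_negative n k"
    proof (cases "even k")
      case True
      then show ?thesis using that(1) assms by (intro has_negative_odd_even)
    next
      case False
      \<comment> \<open>Parity supplies the bounds: k is odd and neither 1 nor 3, while n - k is
        even and neither 0 nor 2.\<close>
      then have "5 \<le> k" "k + 4 \<le> n" using k assms that(1) by simp_all presburger+
      then show ?thesis using that(1) False by (intro has_negative_odd_odd)
    qed
    then show False using that(2) assms p_positive_triangle_iff_not_has_negative by blast
  qed
  moreover have "k \<in> {1, 3, n div 2, n div 2 + 1, n - 2, n}" if "4 \<le> n" "even n" "?pos"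
  proof (rule ccontr)
    assume k: "k \<notin> {1, 3, n div 2, n div 2 + 1, n - 2, n}"
    from that(2) obtain h where h: "n = 2 * h" by (rule evenE)
    have "has_negative n k"
    proof (cases "k < h")
      case True
      then show ?thesis using k assms h by (intro has_negative_even) auto
    next
      case False
      \<comment> \<open>Here k >= h + 2, so the mirrored index n + 1 - k is at most h - 1, and it is
        neither 1 nor 3 because k is neither n nor n - 2.\<close>
      then have "has_negative n (n + 1 - k)"
        using k assms h that(1) by (intro has_negative_even) auto
      then show ?thesis by (rule has_negative_symmetric[OF assms])
    qed
    then show False using that(3) assms p_positive_triangle_iff_not_has_negative by blast
  qed
  moreover have "k = 1 \<or> k = n" if "n \<le> 2" using that assms by auto
  ultimately show ?thesis using ends third half by auto
qed

end
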